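(* For every integer $k\ge 1$ there exists a simple, nonplanar, $3$-connected, bipartite cubic graph $U_k$ with $2+10k$ vertices and $K'(U_k,3)=1$.
   Context: A proper $3$-edge coloring assigns colors from $\{1,2,3\}$ to edges so that adjacent edges receive different colors. For colors $a\neq b$, an edge-Kempe chain is a connected component of the subgraph of edges colored $a$ or $b$; an edge-Kempe switch interchanges $a$ and $b$ on one chain. $K'(G,3)$ is the number of equivalence classes of proper $3$-edge colorings of $G$ under the equivalence relation generated by edge-Kempe switches. *)

theory Defs
  imports "HOL-Analysis.Analysis"
begin

definition simple_graph :: "'a set \<Rightarrow> 'a set set \<Rightarrow> bool" where
  "simple_graph V E \<longleftrightarrow> finite V \<and>
     (\<forall>e\<in>E. \<exists>u v. u \<noteq> v \<and> u \<in> V \<and> v \<in> V \<and> e = {u, v})"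

definition cubic :: "'a set \<Rightarrow> 'a set set \<Rightarrow> bool" where
  "cubic V E \<longleftrightarrow> (\<forall>v\<in>V. card {e\<in>E. v \<in> e} = 3)"

definition bipartite :: "'a set \<Rightarrow> 'a set set \<Rightarrow> bool" where
  "bipartite V E \<longleftrightarrow> (\<exists>A. A \<subseteq> V \<and> (\<forall>e\<in>E. card (e \<inter> A) = 1))"

definition connected_on :: "'a set \<Rightarrow> 'a set set \<Rightarrow> bool" where
  "connected_on W E \<longleftrightarrow> W \<noteq> {} \<and>
     (\<forall>u\<in>W. \<forall>v\<in>W. (\<lambda>x y. x \<in> W \<and> y \<in> W \<and> {x, y} \<in> E)\<^sup>*\<^sup>* u v)"

definition k_connected :: "nat \<Rightarrow> 'a set \<Rightarrow> 'a set set \<Rightarrow> bool" where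
  "k_connected k V E \<longleftrightarrow> card V > k \<and>
     (\<forall>S \<subseteq> V. card S < k \<longrightarrow> connected_on (V - S) E)"

definition planar :: "'a set \<Rightarrow> 'a set set \<Rightarrow> bool" where
  "planar V E \<longleftrightarrow> (\<exists>(p :: 'a \<Rightarrow> complex) (\<gamma> :: 'a set \<Rightarrow> real \<Rightarrow> complex).
     inj_on p V \<and>
     (\<forall>e\<in>E. arc (\<gamma> e) \<and> {pathstart (\<gamma> e), pathfinish (\<gamma> e)} = p ` e) \<and>
     (\<forall>e\<in>E. \<forall>v\<in>V. p v \<in> path_image (\<gamma> e) \<longrightarrow> v \<in> e) \<and>
     (\<forall>e\<in>E. \<forall>f\<in>E. e \<noteq> f \<longrightarrow> path_image (\<gamma> e) \<inter> path_image (\<gamma> f) \<subseteq> p ` (e \<inter> f)))"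

definition edge_colorings3 :: "'a set set \<Rightarrow> ('a set \<Rightarrow> nat) set" where
  "edge_colorings3 E = {c \<in> E \<rightarrow>\<^sub>E {1, 2, 3}.
      \<forall>e\<in>E. \<forall>f\<in>E. e \<noteq> f \<and> e \<inter> f \<noteq> {} \<longrightarrow> c e \<noteq> c f}"

definition ab_adj :: "'a set set \<Rightarrow> ('a set \<Rightarrow> nat) \<Rightarrow> nat \<Rightarrow> nat \<Rightarrow> 'a set \<Rightarrow> 'a set \<Rightarrow> bool" where
  "ab_adj E c a b e f \<longleftrightarrow> e \<in> E \<and> f \<in> E \<and> c e \<in> {a, b} \<and> c f \<in> {a, b} \<and> e \<inter> f \<noteq> {}"

definition kempe_chain :: "'a set set \<Rightarrow> ('a set \<Rightarrow> nat) \<Rightarrow> nat \<Rightarrow> nat \<Rightarrow> 'a set set \<Rightarrow> bool" where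
  "kempe_chain E c a b C \<longleftrightarrow>
     (\<exists>e\<in>E. c e \<in> {a, b} \<and> C = {f. (ab_adj E c a b)\<^sup>*\<^sup>* e f})"

definition kempe_switch :: "('a set \<Rightarrow> nat) \<Rightarrow> nat \<Rightarrow> nat \<Rightarrow> 'a set set \<Rightarrow> ('a set \<Rightarrow> nat)" where
  "kempe_switch c a b C = (\<lambda>e. if e \<in> C then (if c e = a then b else if c e = b then a else c e) else c e)"

definition kempe_step :: "'a set set \<Rightarrow> ('a set \<Rightarrow> nat) \<Rightarrow> ('a set \<Rightarrow> nat) \<Rightarrow> bool" where
  "kempe_step E c c' \<longleftrightarrow> (\<exists>a b C. a \<in> {1, 2, 3} \<and> b \<in> {1, 2, 3} \<and> a \<noteq> b \<and>
      kempe_chain E c a b C \<and> c' = kempe_switch c a b C)"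

definition kempe_equiv :: "'a set set \<Rightarrow> (('a set \<Rightarrow> nat) \<times> ('a set \<Rightarrow> nat)) set" where
  "kempe_equiv E = {(c, c'). c \<in> edge_colorings3 E \<and> c' \<in> edge_colorings3 E \<and>
      (\<lambda>x y. kempe_step E x y \<or> kempe_step E y x)\<^sup>*\<^sup>* c c'}"

definition K_edge3 :: "'a set \<Rightarrow> 'a set set \<Rightarrow> nat" where
  "K_edge3 V E = card (edge_colorings3 E // kempe_equiv E)"

end

theory Submission
  imports Defs
begin

text \<open>The graphs are iterated star products of the Franklin graph: a vertex \<open>v\<close> of the graph built so far is
  replaced by the Franklin graph minus a vertex \<open>u\<close>, which adds \<open>12 - 2 = 10\<close> vertices.

  In a proper 3-colouring of a star product the three edges of the cut have different colours, so the
  colouring restricts to proper colourings of both factors. A Kempe switch in the old graph lifts to the star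
  product: if it involves the cut, interchange the two colours on the whole gadget as well. Hence the
  old part of a colouring can be brought to any prescribed form, and the gadget can then be
  adjusted by switches which avoid \<open>u\<close>; that these suffice for the Franklin graph is a finite check on its
  48 colourings.

  For nonplanarity, the first Franklin graph contains a theta subgraph whose complement is connected and is
  attached to the interior of each of the three paths. The vertices replaced are always chosen off the theta
  subgraph, so this configuration persists. In the plane it is impossible: by the Jordan
  curve theorem, one of the arcs of a theta curve lies inside the cycle of the other two, and
  the closure of a component of the complement meets at most two of the open arcs.\<close>

section \<open>Theta curves in the plane\<close>

text \<open>The two factors of a star product play unequal roles. A switch in the old graph that
  crosses the cut does no lasting harm, because the gadget can be recoloured wholesale and repaired
  later. A switch in the gadget that crosses the cut would undo what was achieved on the old side.
  So the old graph only has to be \<open>kempe_connected\<close>, while the gadget needs the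
  stronger \<open>kempe_gadget\<close>. The gadget also supplies the distinctness of the colours on
  the cut: its colourings are enumerated with no condition at \<open>u\<close>, and each turns out
  to use three colours there. Properness at \<open>v\<close> follows, since both factors share the
  cut edges. The old graph need not be a subgraph of the star product, so nonplanarity is carried
  through the induction by an explicit configuration. A colouring has to be carried along as well:
  without one, the number of classes would be 0. For this reason the bijection across the cut is
  chosen only after both factors have been coloured.\<close>

definition theta_curve :: "(real \<Rightarrow> complex) \<Rightarrow> (real \<Rightarrow> complex) \<Rightarrow> (real \<Rightarrow> complex) \<Rightarrow> complex \<Rightarrow> complex \<Rightarrow> bool" where
  "theta_curve g1 g2 g3 a b \<longleftrightarrow> a \<noteq> b \<and>
     (\<forall>g\<in>{g1, g2, g3}. arc g \<and> pathstart g = a \<and> pathfinish g = b) \<and>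
     path_image g1 \<inter> path_image g2 = {a, b} \<and>
     path_image g1 \<inter> path_image g3 = {a, b} \<and>
     path_image g2 \<inter> path_image g3 = {a, b}"

lemma theta_curve_perm:
  assumes "theta_curve g1 g2 g3 a b"
  shows "theta_curve g2 g1 g3 a b" "theta_curve g1 g3 g2 a b" "theta_curve g2 g3 g1 a b"
  using assms unfolding theta_curve_def by (auto simp: Int_commute)

lemma two_arcs_Jordan:
  fixes g h :: "real \<Rightarrow> complex"
  assumes "arc g" "arc h" "pathstart g = a" "pathfinish g = b" "pathstart h = a" "pathfinish h = b"
    and "path_image g \<inter> path_image h = {a, b}"
  defines "J \<equiv> path_image g \<union> path_image h"
  shows "inside J \<noteq> {}" "open (inside J)" "connected (inside J)" "open (outside J)"
    "connected (outside J)" "frontier (inside J) = J" "compact J" "frontier (outside J) = J"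
proof -
  have s: "simple_path (g +++ reversepath h)"
    using assms by (intro simple_path_join_loop) (auto simp: arc_reversepath)
  have "path_image (g +++ reversepath h) = J"
    using assms by (simp add: path_image_join)
  then show "inside J \<noteq> {}" "open (inside J)" "connected (inside J)" "open (outside J)"
    "connected (outside J)" "frontier (inside J) = J" "compact J" "frontier (outside J) = J"
    using Jordan_inside_outside[OF s] assms(1-6) compact_simple_path_image[OF s] by auto
qed

lemma connected_inside_or_outside:
  fixes T :: "complex set"
  assumes "connected T" "T \<inter> J = {}" "open (inside J)" "open (outside J)"
  shows "T \<subseteq> inside J \<or> T \<subseteq> outside J"
proof -
  have "T \<subseteq> inside J \<union> outside J" using assms(2) by auto
  then show ?thesis
    using connectedD[OF assms(1,3,4)] inside_Int_outside[of J] by blast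
qed

lemma closure_inside_Jordan:
  assumes "frontier (inside J) = J" "T \<subseteq> inside J" shows "closure T \<subseteq> inside J \<union> J"
  using closure_mono[OF assms(2)] closure_Un_frontier[of "inside J"] assms(1) by auto

lemma closure_outside_Jordan:
  assumes "frontier (outside J) = J" "T \<subseteq> outside J" shows "closure T \<subseteq> outside J \<union> J"
  using closure_mono[OF assms(2)] closure_Un_frontier[of "outside J"] assms(1) by auto

text \<open>The chord \<open>g3\<close> cuts the inside of the cycle of \<open>g1\<close> and
  \<open>g2\<close> into the insides of the two smaller cycles. Together with the outside this
  leaves three regions for \<open>T\<close>, and the closure of each misses one of the three open
  arcs.\<close>

lemma theta_curve_chord_inside:
  assumes th: "theta_curve g1 g2 g3 a b"
    and ins: "path_image g3 \<inter> inside (path_image g1 \<union> path_image g2) \<noteq> {}"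
    and T: "connected T" "T \<inter> (path_image g1 \<union> path_image g2 \<union> path_image g3) = {}"
    and x: "x1 \<in> closure T" "x1 \<in> path_image g1 - {a, b}" "x2 \<in> closure T" "x2 \<in> path_image g2 - {a, b}"
      "x3 \<in> closure T" "x3 \<in> path_image g3 - {a, b}"
  shows False
proof -
  let ?P1 = "path_image g1" and ?P2 = "path_image g2" and ?P3 = "path_image g3"
  have arcs: "arc g1" "arc g2" "arc g3"
    and ends: "pathstart g1 = a" "pathstart g2 = a" "pathstart g3 = a"
      "pathfinish g1 = b" "pathfinish g2 = b" "pathfinish g3 = b"
    and I: "?P1 \<inter> ?P2 = {a, b}" "?P1 \<inter> ?P3 = {a, b}" "?P2 \<inter> ?P3 = {a, b}" and ab: "a \<noteq> b"
    using th by (auto simp: theta_curve_def)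
  note J12 = two_arcs_Jordan[OF arcs(1,2) ends(1,4,2,5) I(1)]
  note J13 = two_arcs_Jordan[OF arcs(1,3) ends(1,4,3,6) I(2)]
  note J23 = two_arcs_Jordan[OF arcs(2,3) ends(2,5,3,6) I(3)]
  obtain split: "inside (?P1 \<union> ?P3) \<inter> inside (?P2 \<union> ?P3) = {}"
    "inside (?P1 \<union> ?P3) \<union> inside (?P2 \<union> ?P3) \<union> (?P3 - {a, b}) = inside (?P1 \<union> ?P2)"
    by (rule split_inside_simple_closed_curve[OF arcs(1)[THEN arc_imp_simple_path] ends(1,4)
          arcs(2)[THEN arc_imp_simple_path] ends(2,5) arcs(3)[THEN arc_imp_simple_path] ends(3,6)
          ab I ins])
  have no12: "inside (?P1 \<union> ?P2) \<inter> (?P1 \<union> ?P2) = {}" by simp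
  have "T \<subseteq> inside (?P1 \<union> ?P2) \<or> T \<subseteq> outside (?P1 \<union> ?P2)"
    using connected_inside_or_outside[OF T(1) _ J12(2,4)] T(2) by blast
  then show False
  proof
    assume "T \<subseteq> outside (?P1 \<union> ?P2)"
    then have "x3 \<in> outside (?P1 \<union> ?P2) \<union> (?P1 \<union> ?P2)"
      using closure_outside_Jordan[OF J12(8)] x(5) by blast
    moreover have "x3 \<in> inside (?P1 \<union> ?P2)" using split(2) x(6) by blast
    ultimately show False using no12 inside_Int_outside by blast
  next
    assume "T \<subseteq> inside (?P1 \<union> ?P2)"
    then have "T \<subseteq> inside (?P1 \<union> ?P3) \<union> inside (?P2 \<union> ?P3)" using split(2) T(2) by blast
    then have "T \<subseteq> inside (?P1 \<union> ?P3) \<or> T \<subseteq> inside (?P2 \<union> ?P3)"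
      using connectedD[OF T(1) J13(2) J23(2)] split(1) by blast
    then show False
    proof
      assume "T \<subseteq> inside (?P1 \<union> ?P3)"
      then have "x2 \<in> inside (?P1 \<union> ?P3) \<union> (?P1 \<union> ?P3)"
        using closure_inside_Jordan[OF J13(6)] x(3) by blast
      then show False using x(4) I split(2) no12 by blast
    next
      assume "T \<subseteq> inside (?P2 \<union> ?P3)"
      then have "x1 \<in> inside (?P2 \<union> ?P3) \<union> (?P2 \<union> ?P3)"
        using closure_inside_Jordan[OF J23(6)] x(1) by blast
      then show False using x(2) I split(2) no12 by blast
    qed
  qed
qed

text \<open>Neither cycle enters the inside of the other. If the two insides met, connectedness
  would give inclusion both ways, hence equality. Then the frontiers, which are the cycles
  themselves, would coincide, although \<open>x\<close> lies on only one of them.\<close>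

lemma theta_curve_insides_disjoint:
  assumes th: "theta_curve g1 g2 g3 a b"
    and x: "x \<in> path_image g2 - {a, b}"
    and o3: "path_image g3 \<inter> inside (path_image g1 \<union> path_image g2) = {}"
    and o2: "path_image g2 \<inter> inside (path_image g1 \<union> path_image g3) = {}"
  shows "inside (path_image g1 \<union> path_image g2) \<inter> inside (path_image g1 \<union> path_image g3) = {}"
proof (rule ccontr)
  define J where "J = path_image g1 \<union> path_image g2"
  define K where "K = path_image g1 \<union> path_image g3"
  assume "inside (path_image g1 \<union> path_image g2) \<inter> inside (path_image g1 \<union> path_image g3) \<noteq> {}"
  then obtain z where z: "z \<in> inside J" "z \<in> inside K" unfolding J_def K_def by blast
  have arcs: "arc g1" "arc g2" "arc g3"
    and ends: "pathstart g1 = a" "pathstart g2 = a" "pathstart g3 = a"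
      "pathfinish g1 = b" "pathfinish g2 = b" "pathfinish g3 = b"
    and I: "path_image g1 \<inter> path_image g2 = {a, b}" "path_image g1 \<inter> path_image g3 = {a, b}"
      "path_image g2 \<inter> path_image g3 = {a, b}"
    using th by (simp_all add: theta_curve_def)
  note J = two_arcs_Jordan[OF arcs(1,2) ends(1,4,2,5) I(1), folded J_def]
  note K = two_arcs_Jordan[OF arcs(1,3) ends(1,4,3,6) I(2), folded K_def]
  have "inside J \<inter> K = {}"
    using o3[folded J_def] inside_no_overlap[of J] unfolding J_def K_def by blast
  then have "inside J \<subseteq> inside K"
    using connected_inside_or_outside[OF J(3) _ K(2,4)] z inside_Int_outside[of K] by blast
  moreover have "inside K \<inter> J = {}"
    using o2[folded K_def] inside_no_overlap[of K] unfolding J_def K_def by blast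
  then have "inside K \<subseteq> inside J"
    using connected_inside_or_outside[OF K(3) _ J(2,4)] z inside_Int_outside[of J] by blast
  ultimately have "inside J = inside K" by (rule equalityI)
  then have "J = K" using J(6) K(6) by metis
  moreover have "x \<in> J" "x \<notin> K" using x I unfolding J_def K_def by blast+
  ultimately show False by simp
qed

text \<open>If no arc lay inside the cycle of the other two, a point \<open>p\<close> inside the first cycle would be
  outside the other two; these meet in a connected set, so by Janiszewski's theorem \<open>p\<close> could
  be joined to infinity off the whole theta curve.\<close>

lemma theta_curve_some_chord_inside:
  assumes th: "theta_curve g1 g2 g3 a b"
    and x: "x1 \<in> path_image g1 - {a, b}" "x2 \<in> path_image g2 - {a, b}"
    and o3: "path_image g3 \<inter> inside (path_image g1 \<union> path_image g2) = {}"
    and o2: "path_image g2 \<inter> inside (path_image g1 \<union> path_image g3) = {}"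
    and o1: "path_image g1 \<inter> inside (path_image g2 \<union> path_image g3) = {}"
  shows False
proof -
  let ?P1 = "path_image g1" and ?P2 = "path_image g2" and ?P3 = "path_image g3"
  have arcs: "arc g1" "arc g2" "arc g3"
    and ends: "pathstart g1 = a" "pathstart g2 = a" "pathstart g3 = a"
      "pathfinish g1 = b" "pathfinish g2 = b" "pathfinish g3 = b"
    and I: "?P1 \<inter> ?P2 = {a, b}" "?P1 \<inter> ?P3 = {a, b}" "?P2 \<inter> ?P3 = {a, b}"
    using th by (auto simp: theta_curve_def)
  note J12 = two_arcs_Jordan[OF arcs(1,2) ends(1,4,2,5) I(1)]
  note J13 = two_arcs_Jordan[OF arcs(1,3) ends(1,4,3,6) I(2)]
  note J23 = two_arcs_Jordan[OF arcs(2,3) ends(2,5,3,6) I(3)]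
  obtain p where p: "p \<in> inside (?P1 \<union> ?P2)" using J12(1) by blast
  have "inside (?P1 \<union> ?P2) \<inter> inside (?P1 \<union> ?P3) = {}"
    by (rule theta_curve_insides_disjoint[OF th x(2) o3 o2])
  moreover have "inside (?P2 \<union> ?P1) \<inter> inside (?P2 \<union> ?P3) = {}"
    by (rule theta_curve_insides_disjoint[OF theta_curve_perm(1)[OF th] x(1) _ o1])
      (use o3 in \<open>simp add: Un_commute\<close>)
  ultimately have p': "p \<notin> inside (?P1 \<union> ?P3)" "p \<notin> inside (?P2 \<union> ?P3)"
    using p by (auto simp: Un_commute)
  have pn: "p \<notin> ?P1 \<union> ?P2 \<union> ?P3"
    using p o3 inside_no_overlap[of "?P1 \<union> ?P2"] by blast
  have out: "p \<in> outside (?P1 \<union> ?P3)" "p \<in> outside (?P2 \<union> ?P3)"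
    using p' pn by (auto simp: outside_inside)
  obtain q where q: "q \<in> outside (?P1 \<union> ?P2 \<union> ?P3)"
    using outside_bounded_nonempty[of "?P1 \<union> ?P2 \<union> ?P3"] arcs
    by (auto simp: bounded_arc_image)
  have q': "q \<in> outside (?P1 \<union> ?P3)" "q \<in> outside (?P2 \<union> ?P3)" "q \<in> outside (?P1 \<union> ?P2)"
    using q outside_mono[of "?P1 \<union> ?P3" "?P1 \<union> ?P2 \<union> ?P3"]
      outside_mono[of "?P2 \<union> ?P3" "?P1 \<union> ?P2 \<union> ?P3"]
      outside_mono[of "?P1 \<union> ?P2" "?P1 \<union> ?P2 \<union> ?P3"] by blast+
  have sub: "outside J \<subseteq> - J" for J :: "complex set" using outside_no_overlap[of J] by blast
  have "connected_component (- (?P1 \<union> ?P3)) p q" "connected_component (- (?P2 \<union> ?P3)) p q"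
    using connected_componentI[OF J13(5) sub out(1) q'(1)]
      connected_componentI[OF J23(5) sub out(2) q'(2)] .
  moreover have "(?P1 \<union> ?P3) \<inter> (?P2 \<union> ?P3) = ?P3"
    using I by blast
  ultimately have "connected_component (- ((?P1 \<union> ?P3) \<union> (?P2 \<union> ?P3))) p q"
    using Janiszewski[OF J13(7) compact_imp_closed[OF J23(7)]] connected_arc_image[OF arcs(3)] by simp
  then have "connected_component (- (?P1 \<union> ?P2)) p q"
    by (rule connected_component_of_subset) blast
  then have "q \<in> inside (?P1 \<union> ?P2)" using inside_same_component p by blast
  then show False using q'(3) inside_Int_outside by blast
qed

text \<open>Contact is expressed by closure points, so that \<open>T\<close> can contain edges
  running to the theta curve without their last points and still be disjoint from it. Permuting the
  arcs reduces everything to the case of a chord inside a cycle.\<close>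

theorem theta_curve_no_tripod:
  assumes th: "theta_curve g1 g2 g3 a b"
    and T: "connected T" "T \<inter> (path_image g1 \<union> path_image g2 \<union> path_image g3) = {}"
    and x: "x1 \<in> closure T" "x1 \<in> path_image g1 - {a, b}" "x2 \<in> closure T" "x2 \<in> path_image g2 - {a, b}"
      "x3 \<in> closure T" "x3 \<in> path_image g3 - {a, b}"
  shows False
proof -
  let ?P1 = "path_image g1" and ?P2 = "path_image g2" and ?P3 = "path_image g3"
  consider "?P3 \<inter> inside (?P1 \<union> ?P2) \<noteq> {}" | "?P2 \<inter> inside (?P1 \<union> ?P3) \<noteq> {}"
    | "?P1 \<inter> inside (?P2 \<union> ?P3) \<noteq> {}"
    using theta_curve_some_chord_inside[OF th x(2,4)] by blast
  then show False
  proof cases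
    case 1
    show ?thesis by (rule theta_curve_chord_inside[OF th 1 T x])
  next
    case 2
    have "T \<inter> (?P1 \<union> ?P3 \<union> ?P2) = {}" using T(2) by (simp only: Un_ac)
    then show ?thesis
      by (rule theta_curve_chord_inside[OF theta_curve_perm(2)[OF th] 2 T(1) _ x(1,2,5,6,3,4)])
  next
    case 3
    have "T \<inter> (?P2 \<union> ?P3 \<union> ?P1) = {}" using T(2) by (simp only: Un_ac)
    then show ?thesis
      by (rule theta_curve_chord_inside[OF theta_curve_perm(3)[OF th] 3 T(1) _ x(3,4,5,6,1,2)])
  qed
qed

section \<open>A nonplanarity criterion\<close>

text \<open>Prepares the edges that link the rest of the graph to the theta curve: without the foot,
  such an edge stays connected and keeps the foot as a limit point. Both facts hold because it is
  the continuous image of a half-open interval.\<close>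

lemma arc_minus_pathstart:
  fixes g :: "real \<Rightarrow> complex"
  assumes "arc g"
  shows "connected (path_image g - {pathstart g})"
    and "pathstart g \<in> closure (path_image g - {pathstart g})"
proof -
  have c: "continuous_on {0..1} g" and i: "inj_on g {0..1}"
    using assms by (auto simp: arc_def path_def)
  have eq: "path_image g - {pathstart g} = g ` {0<..1}"
  proof -
    have "{0<..1} = {0..1} - {0::real}" by auto
    then show ?thesis
      using inj_on_image_set_diff[OF i, of "{0..1}" "{0}"] by (simp add: path_image_def pathstart_def)
  qed
  have "connected (g ` {0<..1})"
    by (rule connected_continuous_image) (auto intro: continuous_on_subset[OF c])
  then show "connected (path_image g - {pathstart g})" by (simp add: eq)
  have "g ` closure {0<..1} \<subseteq> closure (g ` {0<..1})"
    by (rule image_closure_subset) (auto simp: c closure_subset)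
  then show "pathstart g \<in> closure (path_image g - {pathstart g})"
    unfolding eq by (auto simp: pathstart_def)
qed

text \<open>A theta subgraph with branch vertices \<open>a\<close>, \<open>b\<close> and paths \<open>a-x-b\<close>, \<open>a-y-b\<close>, \<open>a-p-q-r-b\<close>,
  each with an inner vertex adjacent to the connected rest of the graph: contracting
  the rest to a point gives a subdivision of the complete bipartite graph on 3 + 3 vertices.\<close>

definition theta_minor :: "'a set \<Rightarrow> 'a set set \<Rightarrow> 'a list \<Rightarrow> bool" where
  "theta_minor V E ts \<longleftrightarrow> (\<exists>a b x y p q r. ts = [a, b, x, y, p, q, r] \<and> distinct ts \<and> set ts \<subseteq> V \<and>
     {{a, x}, {x, b}, {a, y}, {y, b}, {a, p}, {p, q}, {q, r}, {r, b}} \<subseteq> E \<and>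
     connected_on (V - set ts) E \<and>
     (\<forall>t\<in>{x, y, p}. \<exists>w\<in>V - set ts. {t, w} \<in> E))"

text \<open>A drawing would turn the three paths into a theta curve and the drawn rest, with its
  link edges, into a tripod \<open>T\<close>.\<close>

lemma theta_minor_not_planar:
  assumes minor: "theta_minor V E ts"
  shows "\<not> planar V E"
proof
  assume "planar V E"
  then obtain pt :: "'a \<Rightarrow> complex" and \<gamma> where inj: "inj_on pt V"
    and arcs: "\<And>e. e \<in> E \<Longrightarrow> arc (\<gamma> e) \<and> {pathstart (\<gamma> e), pathfinish (\<gamma> e)} = pt ` e"
    and vert: "\<And>e v. e \<in> E \<Longrightarrow> v \<in> V \<Longrightarrow> pt v \<in> path_image (\<gamma> e) \<Longrightarrow> v \<in> e"
    and cross: "\<And>e f. e \<in> E \<Longrightarrow> f \<in> E \<Longrightarrow> e \<noteq> f \<Longrightarrow>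
      path_image (\<gamma> e) \<inter> path_image (\<gamma> f) \<subseteq> pt ` (e \<inter> f)"
    unfolding planar_def by metis
  obtain a b x y p q r where ts: "ts = [a, b, x, y, p, q, r]" "distinct ts" "set ts \<subseteq> V"
    and E8: "{{a, x}, {x, b}, {a, y}, {y, b}, {a, p}, {p, q}, {q, r}, {r, b}} \<subseteq> E"
    and con: "connected_on (V - set ts) E"
    and link: "\<forall>t\<in>{x, y, p}. \<exists>w\<in>V - set ts. {t, w} \<in> E"
    using minor unfolding theta_minor_def by metis
  define W where "W = V - set ts"
  obtain wx wy wp where w: "wx \<in> W" "{x, wx} \<in> E" "wy \<in> W" "{y, wy} \<in> E" "wp \<in> W" "{p, wp} \<in> E"
    using link unfolding W_def by (metis insertCI)
  have dist: "distinct [a, b, x, y, p, q, r]" using ts by simp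
  define I where "I e = path_image (\<gamma> e)" for e
  \<comment> \<open>A drawing fixes the ends of an edge only as a set, so the arc may have to be
    reversed.\<close>
  have oriented: "\<exists>g. arc g \<and> pathstart g = pt u \<and> pathfinish g = pt v \<and> path_image g = I {u, v}"
    if "{u, v} \<in> E" for u v
  proof -
    have "{pathstart (\<gamma> {u, v}), pathfinish (\<gamma> {u, v})} = {pt u, pt v}" and g: "arc (\<gamma> {u, v})"
      using arcs[OF that] by auto
    then consider "pathstart (\<gamma> {u, v}) = pt u" "pathfinish (\<gamma> {u, v}) = pt v"
      | "pathstart (\<gamma> {u, v}) = pt v" "pathfinish (\<gamma> {u, v}) = pt u"
      by (auto simp: doubleton_eq_iff)
    then show ?thesis
    proof cases
      case 1 then show ?thesis using g I_def by blast
    next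
      case 2 then show ?thesis
        using g by (intro exI[of _ "reversepath (\<gamma> {u, v})"]) (simp add: I_def arc_reversepath)
    qed
  qed
  have ends: "pt u \<in> I {u, v}" "pt v \<in> I {u, v}" if uv: "{u, v} \<in> E" for u v
    using oriented[OF uv] pathstart_in_path_image pathfinish_in_path_image by metis+
  have sub: "I e \<inter> I f \<subseteq> pt ` S" if "e \<in> E" "f \<in> E" "e \<noteq> f" "e \<inter> f \<subseteq> S" for e f S
    using cross[OF that(1-3)] that(4) unfolding I_def by blast
  define F1 where "F1 = {{a, x}, {x, b}}"
  define F2 where "F2 = {{a, y}, {y, b}}"
  define F3 where "F3 = {{a, p}, {p, q}, {q, r}, {r, b}}"
  have FE: "F1 \<subseteq> E" "F2 \<subseteq> E" "F3 \<subseteq> E" using E8 unfolding F1_def F2_def F3_def by auto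
  have UI: "(\<Union>e\<in>F. I e) \<inter> (\<Union>e\<in>G. I e) \<subseteq> pt ` S"
    if "F \<subseteq> E" "G \<subseteq> E" "\<forall>e\<in>F. \<forall>f\<in>G. e \<noteq> f \<and> e \<inter> f \<subseteq> S" for F G S
    using sub that by blast
  have meet: "(\<Union>e\<in>F1. I e) \<inter> (\<Union>e\<in>F2. I e) = {pt a, pt b}"
    "(\<Union>e\<in>F1. I e) \<inter> (\<Union>e\<in>F3. I e) = {pt a, pt b}"
    "(\<Union>e\<in>F2. I e) \<inter> (\<Union>e\<in>F3. I e) = {pt a, pt b}"
  proof -
    have *: "(\<Union>e\<in>F. I e) \<inter> (\<Union>e\<in>G. I e) = {pt a, pt b}"
      if "F \<in> {F1, F2, F3}" "G \<in> {F1, F2, F3}" "\<forall>e\<in>F. \<forall>f\<in>G. e \<noteq> f \<and> e \<inter> f \<subseteq> {a, b}" for F G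
    proof (rule equalityI)
      have "F \<subseteq> E" "G \<subseteq> E" using that FE by auto
      from UI[OF this that(3)] show "(\<Union>e\<in>F. I e) \<inter> (\<Union>e\<in>G. I e) \<subseteq> {pt a, pt b}" by simp
      have "pt a \<in> (\<Union>e\<in>F. I e) \<and> pt b \<in> (\<Union>e\<in>F. I e)" if "F \<in> {F1, F2, F3}" for F
        using that ends E8 unfolding F1_def F2_def F3_def by auto
      from this[OF that(1)] this[OF that(2)]
      show "{pt a, pt b} \<subseteq> (\<Union>e\<in>F. I e) \<inter> (\<Union>e\<in>G. I e)" by blast
    qed
    have "\<forall>e\<in>F1. \<forall>f\<in>F2. e \<noteq> f \<and> e \<inter> f \<subseteq> {a, b}"
      "\<forall>e\<in>F1. \<forall>f\<in>F3. e \<noteq> f \<and> e \<inter> f \<subseteq> {a, b}" "\<forall>e\<in>F2. \<forall>f\<in>F3. e \<noteq> f \<and> e \<inter> f \<subseteq> {a, b}"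
      using dist unfolding F1_def F2_def F3_def by (auto simp: doubleton_eq_iff)
    note this[THEN *[rotated 2]]
    then show "(\<Union>e\<in>F1. I e) \<inter> (\<Union>e\<in>F2. I e) = {pt a, pt b}"
      "(\<Union>e\<in>F1. I e) \<inter> (\<Union>e\<in>F3. I e) = {pt a, pt b}"
      "(\<Union>e\<in>F2. I e) \<inter> (\<Union>e\<in>F3. I e) = {pt a, pt b}"
      by simp_all
  qed
  \<comment> \<open>Extends a path by one edge. The new edge shares only the current end
    \<open>u\<close> with the earlier ones, so the concatenation is again an arc.\<close>
  have join: "\<exists>h. arc h \<and> pathstart h = pathstart g \<and> pathfinish h = pt v \<and>
      path_image h = (\<Union>e\<in>insert {u, v} F. I e)"
    if g: "arc g" "pathfinish g = pt u" "path_image g = (\<Union>e\<in>F. I e)"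
      and uv: "{u, v} \<in> E" "F \<subseteq> E" "\<forall>e\<in>F. e \<noteq> {u, v} \<and> e \<inter> {u, v} \<subseteq> {u}" for g u v F
  proof -
    obtain h where h: "arc h" "pathstart h = pt u" "pathfinish h = pt v" "path_image h = I {u, v}"
      using oriented[OF uv(1)] by blast
    have "path_image g \<inter> path_image h \<subseteq> {pathstart h}"
      using UI[of F "{{u, v}}" "{u}"] uv unfolding g(3) h(2,4) by simp
    then show ?thesis
      using arc_join[OF g(1) h(1)] g h
      by (intro exI[of _ "g +++ h"]) (auto simp: path_image_join)
  qed
  have arc2: "\<exists>g. arc g \<and> pathstart g = pt a \<and> pathfinish g = pt b \<and>
      path_image g = (\<Union>e\<in>{{a, z}, {z, b}}. I e)" if z: "{a, z} \<in> E" "{z, b} \<in> E" "distinct [a, b, z]" for z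
  proof -
    obtain g where g: "arc g" "pathstart g = pt a" "pathfinish g = pt z"
      "path_image g = (\<Union>e\<in>{{a, z}}. I e)"
      using oriented[OF z(1)] by auto
    obtain h where "arc h" "pathstart h = pathstart g" "pathfinish h = pt b"
      "path_image h = (\<Union>e\<in>{{z, b}, {a, z}}. I e)"
      using join[OF g(1,3,4) z(2)] z by (auto simp: doubleton_eq_iff)
    with g(2) show ?thesis by (metis insert_commute)
  qed
  obtain g1 where g1: "arc g1" "pathstart g1 = pt a" "pathfinish g1 = pt b" "path_image g1 = (\<Union>e\<in>F1. I e)"
    using arc2[of x] E8 dist unfolding F1_def by auto
  obtain g2 where g2: "arc g2" "pathstart g2 = pt a" "pathfinish g2 = pt b" "path_image g2 = (\<Union>e\<in>F2. I e)"
    using arc2[of y] E8 dist unfolding F2_def by auto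
  obtain g3 where g3: "arc g3" "pathstart g3 = pt a" "pathfinish g3 = pt b" "path_image g3 = (\<Union>e\<in>F3. I e)"
  proof -
    obtain h1 where h1: "arc h1" "pathstart h1 = pt a" "pathfinish h1 = pt p"
      "path_image h1 = (\<Union>e\<in>{{a, p}}. I e)"
      using oriented[of a p] E8 by auto
    obtain h2 where h2: "arc h2" "pathstart h2 = pt a" "pathfinish h2 = pt q"
      "path_image h2 = (\<Union>e\<in>{{p, q}, {a, p}}. I e)"
      using join[OF h1(1,3,4), of q] E8 dist h1(2) by (auto simp: doubleton_eq_iff)
    obtain h3 where h3: "arc h3" "pathstart h3 = pt a" "pathfinish h3 = pt r"
      "path_image h3 = (\<Union>e\<in>{{q, r}, {p, q}, {a, p}}. I e)"
      using join[OF h2(1,3,4), of r] E8 dist h2(2) by (auto simp: doubleton_eq_iff)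
    obtain h4 where h4: "arc h4" "pathstart h4 = pt a" "pathfinish h4 = pt b"
      "path_image h4 = (\<Union>e\<in>{{r, b}, {q, r}, {p, q}, {a, p}}. I e)"
      using join[OF h3(1,3,4), of b] E8 dist h3(2) by (auto simp: doubleton_eq_iff)
    have "{{r, b}, {q, r}, {p, q}, {a, p}} = F3" unfolding F3_def by auto
    then show ?thesis using that h4 by metis
  qed
  have "a \<in> V" "b \<in> V" "x \<in> V" "y \<in> V" "p \<in> V" using ts by auto
  then have neq: "pt a \<noteq> pt b" "pt x \<noteq> pt a" "pt x \<noteq> pt b" "pt y \<noteq> pt a" "pt y \<noteq> pt b"
    "pt p \<noteq> pt a" "pt p \<noteq> pt b"
    using inj dist unfolding inj_on_def by auto
  have th: "theta_curve g1 g2 g3 (pt a) (pt b)"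
    unfolding theta_curve_def using g1 g2 g3 meet neq(1) by simp
  define L where "L t w = I {t, w} - {pt t}" for t w
  \<comment> \<open>The sets \<open>L t w\<close> are the link edges without their feet on the theta
    curve. This keeps \<open>T\<close> disjoint from the curve while the feet lie in its
    closure.\<close>
  define T where "T = pt ` W \<union> (\<Union>{I {u, v} |u v. u \<in> W \<and> v \<in> W \<and> {u, v} \<in> E}) \<union>
    L x wx \<union> L y wy \<union> L p wp"
  have Llink: "connected (L t w)" "pt t \<in> closure (L t w)" "pt w \<in> L t w"
    if tw: "{t, w} \<in> E" "t \<in> V" "w \<in> V" "t \<noteq> w" for t w
  proof -
    obtain g where g: "arc g" "pathstart g = pt t" "pathfinish g = pt w" "path_image g = I {t, w}"
      using oriented[OF tw(1)] by blast
    show "connected (L t w)" "pt t \<in> closure (L t w)"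
      using arc_minus_pathstart[OF g(1)] unfolding L_def g(2,4) by auto
    show "pt w \<in> L t w" using ends(2)[OF that(1)] that(2-4) inj unfolding L_def inj_on_def by auto
  qed
  have WV: "W \<subseteq> V" "W \<inter> set ts = {}" unfolding W_def by auto
  have wne: "x \<noteq> wx" "y \<noteq> wy" "p \<noteq> wp" "wx \<in> V" "wy \<in> V" "wp \<in> V"
    using w WV ts(1) by auto
  note Lx = Llink[OF w(2) \<open>x \<in> V\<close> wne(4,1)] and Ly = Llink[OF w(4) \<open>y \<in> V\<close> wne(5,2)]
    and Lp = Llink[OF w(6) \<open>p \<in> V\<close> wne(6,3)]
  have LT: "L x wx \<subseteq> T" "L y wy \<subseteq> T" "L p wp \<subseteq> T" unfolding T_def by auto
  have edgeT: "connected_component T z (pt v)"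
    if "u \<in> W" "v \<in> W" "{u, v} \<in> E" "z \<in> I {u, v}" for u v z
  proof -
    have "I {u, v} \<subseteq> T" using that unfolding T_def by blast
    moreover have "connected (I {u, v})" using arcs[OF that(3)] unfolding I_def by (simp add: connected_arc_image)
    ultimately show ?thesis using ends[OF that(3)] that(4) by (meson connected_componentI)
  qed
  have compW: "connected_component T (pt u) (pt v)" if "u \<in> W" "v \<in> W" for u v
  proof -
    have "(\<lambda>x y. x \<in> W \<and> y \<in> W \<and> {x, y} \<in> E)\<^sup>*\<^sup>* u v"
      using con that unfolding connected_on_def W_def by blast
    then show ?thesis
    proof (induction rule: rtranclp_induct)
      case base
      have "pt u \<in> T" using that unfolding T_def by blast
      then show ?case by simp
    next
      case (step s t)
      then show ?case using edgeT[of s t "pt s"] ends(1)[of s t] connected_component_trans by metis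
    qed
  qed
  have toW: "\<exists>v\<in>W. connected_component T z (pt v)" if z: "z \<in> T" for z
  proof -
    consider "z \<in> pt ` W" | u v where "u \<in> W" "v \<in> W" "{u, v} \<in> E" "z \<in> I {u, v}"
      | "z \<in> L x wx" | "z \<in> L y wy" | "z \<in> L p wp"
      using z unfolding T_def by blast
    then show ?thesis
    proof cases
      case 1 then show ?thesis using compW by blast
    next
      case 2 then show ?thesis using edgeT by blast
    next
      case 3 then show ?thesis using connected_componentI[OF Lx(1) LT(1)] Lx(3) w(1) by blast
    next
      case 4 then show ?thesis using connected_componentI[OF Ly(1) LT(2)] Ly(3) w(3) by blast
    next
      case 5 then show ?thesis using connected_componentI[OF Lp(1) LT(3)] Lp(3) w(5) by blast
    qed
  qed
  have "connected T"
    unfolding connected_iff_connected_component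
    using toW compW by (meson connected_component_sym connected_component_trans)
  moreover have "T \<inter> I e = {}" if e: "e \<in> F1 \<union> F2 \<union> F3" for e
  proof -
    have eE: "e \<in> E" using e FE by blast
    have et: "e \<subseteq> set ts" using e unfolding ts(1) F1_def F2_def F3_def by auto
    have eW: "e \<inter> W = {}" using et WV by blast
    have "pt ` W \<inter> I e = {}" using vert[OF eE] eW WV(1) unfolding I_def by blast
    moreover have "I {u, v} \<inter> I e = {}" if "u \<in> W" "v \<in> W" "{u, v} \<in> E" for u v
      using sub[OF that(3) eE, of "{}"] that eW by blast
    moreover have "L t v \<inter> I e = {}" if "v \<in> W" "{t, v} \<in> E" for t v
      using sub[OF that(2) eE, of "{t}"] that eW unfolding L_def by blast
    ultimately show ?thesis using w unfolding T_def by blast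
  qed
  then have "T \<inter> (path_image g1 \<union> path_image g2 \<union> path_image g3) = {}"
    unfolding g1(4) g2(4) g3(4) by blast
  moreover have "pt x \<in> closure T" "pt y \<in> closure T" "pt p \<in> closure T"
    using Lx(2) Ly(2) Lp(2) LT closure_mono by blast+
  moreover have "pt x \<in> path_image g1 - {pt a, pt b}" "pt y \<in> path_image g2 - {pt a, pt b}"
    "pt p \<in> path_image g3 - {pt a, pt b}"
    unfolding g1(4) g2(4) g3(4) F1_def F2_def F3_def using ends E8 neq by auto
  ultimately show False using theta_curve_no_tripod[OF th] by blast
qed

section \<open>Star products\<close>

definition nbrs :: "'a set set \<Rightarrow> 'a \<Rightarrow> 'a set" where
  "nbrs E v = {x. {x, v} \<in> E}"

definition star_verts :: "'a set \<Rightarrow> 'a \<Rightarrow> 'a set \<Rightarrow> 'a \<Rightarrow> 'a set" where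
  "star_verts V v V' u = (V - {v}) \<union> (V' - {u})"

definition star_edges :: "'a set set \<Rightarrow> 'a \<Rightarrow> 'a set set \<Rightarrow> 'a \<Rightarrow> ('a \<Rightarrow> 'a) \<Rightarrow> 'a set set" where
  "star_edges E v E' u \<sigma> = {e \<in> E. v \<notin> e} \<union> {e \<in> E'. u \<notin> e} \<union> (\<lambda>x. {x, \<sigma> x}) ` nbrs E v"

text \<open>Sends an edge of a factor to the edge of the star product that stands for it. An edge
  \<open>{x, v}\<close> at the deleted vertex becomes the cut edge
  \<open>{x, \<sigma> x}\<close>.\<close>

definition star_lift :: "'a \<Rightarrow> ('a \<Rightarrow> 'a) \<Rightarrow> 'a set \<Rightarrow> 'a set" where
  "star_lift v \<sigma> e = (if v \<in> e then (e - {v}) \<union> \<sigma> ` (e - {v}) else e)"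

lemma simple_graph_edge:
  assumes "simple_graph V E" "e \<in> E"
  obtains x y where "e = {x, y}" "x \<noteq> y" "x \<in> V" "y \<in> V"
  using assms unfolding simple_graph_def by metis

lemma simple_graph_doubleton:
  assumes "simple_graph V E" "{x, y} \<in> E"
  shows "x \<in> V" "y \<in> V" "x \<noteq> y"
  using simple_graph_edge[OF assms] by (metis doubleton_eq_iff insert_absorb2 insertI1)+

lemma simple_graph_edge_at:
  assumes "simple_graph V E" "e \<in> E" "v \<in> e"
  obtains x where "e = {x, v}" "x \<in> nbrs E v" "x \<noteq> v" "x \<in> V"
proof -
  obtain p q where pq: "e = {p, q}" "p \<noteq> q" "p \<in> V" "q \<in> V"
    using simple_graph_edge[OF assms(1,2)] .
  then show thesis
    using that[of p] that[of q] assms unfolding nbrs_def by (auto simp: insert_commute)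
qed

lemma simple_graph_edges_at:
  assumes "simple_graph V E"
  shows "{e \<in> E. v \<in> e} = (\<lambda>x. {x, v}) ` nbrs E v"
proof (intro set_eqI iffI)
  fix e assume "e \<in> {e \<in> E. v \<in> e}"
  then show "e \<in> (\<lambda>x. {x, v}) ` nbrs E v"
    using simple_graph_edge_at[OF assms, of e v] by (metis (no_types, lifting) imageI mem_Collect_eq)
qed (auto simp: nbrs_def)

lemma card_nbrs_cubic:
  assumes "simple_graph V E" "cubic V E" "v \<in> V"
  shows "card (nbrs E v) = 3"
proof -
  have "inj_on (\<lambda>x. {x, v}) (nbrs E v)"
    by (auto simp: inj_on_def doubleton_eq_iff)
  then show ?thesis
    using assms(2,3) unfolding cubic_def simple_graph_edges_at[OF assms(1)] by (metis card_image)
qed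

lemma bipartite_iff:
  assumes "simple_graph V E"
  shows "bipartite V E \<longleftrightarrow> (\<exists>A\<subseteq>V. \<forall>x y. {x, y} \<in> E \<longrightarrow> (x \<in> A \<longleftrightarrow> y \<notin> A))"
proof -
  have "card ({x, y} \<inter> A) = 1 \<longleftrightarrow> (x \<in> A \<longleftrightarrow> y \<notin> A)" if "x \<noteq> y" for x y :: 'a and A
    using that by (cases "x \<in> A"; cases "y \<in> A") (auto simp: Int_insert_left)
  then have "(\<forall>e\<in>E. card (e \<inter> A) = 1) \<longleftrightarrow> (\<forall>x y. {x, y} \<in> E \<longrightarrow> (x \<in> A \<longleftrightarrow> y \<notin> A))" for A
    by (metis assms simple_graph_doubleton(3) simple_graph_edge)
  then show ?thesis unfolding bipartite_def by simp
qed

definition adj_in :: "'a set \<Rightarrow> 'a set set \<Rightarrow> 'a \<Rightarrow> 'a \<Rightarrow> bool" where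
  "adj_in W E x y \<longleftrightarrow> x \<in> W \<and> y \<in> W \<and> {x, y} \<in> E"

lemma connected_on_adj_in:
  "connected_on W E \<longleftrightarrow> W \<noteq> {} \<and> (\<forall>x\<in>W. \<forall>y\<in>W. (adj_in W E)\<^sup>*\<^sup>* x y)"
  unfolding connected_on_def adj_in_def by (rule refl)

lemma adj_in_sym: "(adj_in W E)\<^sup>*\<^sup>* x y \<Longrightarrow> (adj_in W E)\<^sup>*\<^sup>* y x"
proof (induction rule: rtranclp_induct)
  case (step y z)
  then have "adj_in W E z y" by (auto simp: adj_in_def insert_commute)
  then show ?case using step.IH by (rule converse_rtranclp_into_rtranclp)
qed simp

lemma adj_in_mono:
  assumes "(adj_in W E)\<^sup>*\<^sup>* x y" "W \<subseteq> W'" "\<And>p q. p \<in> W \<Longrightarrow> q \<in> W \<Longrightarrow> {p, q} \<in> E \<Longrightarrow> {p, q} \<in> E'"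
  shows "(adj_in W' E')\<^sup>*\<^sup>* x y"
  using assms by (elim rtranclp_mono[THEN predicate2D, rotated]) (auto simp: adj_in_def)

lemma connected_on_root:
  assumes "r \<in> W" "\<And>x. x \<in> W \<Longrightarrow> (adj_in W E)\<^sup>*\<^sup>* x r"
  shows "connected_on W E"
  unfolding connected_on_adj_in using assms by (metis adj_in_sym rtranclp_trans empty_iff)

text \<open>The inverse \<tau> is a parameter to make the setting symmetric: by \<open>swap\<close>,
  every one-sided fact about \<open>V\<close> and \<open>v\<close> also holds for \<open>V'\<close>
  and \<open>u\<close>.\<close>

locale star_product =
  fixes V :: "'a set" and E v V' E' u \<sigma> \<tau>
  assumes simple: "simple_graph V E" "simple_graph V' E'"
    and disjoint: "V \<inter> V' = {}"
    and centre: "v \<in> V" "u \<in> V'"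
    and \<sigma>: "\<And>x. x \<in> nbrs E v \<Longrightarrow> \<sigma> x \<in> nbrs E' u \<and> \<tau> (\<sigma> x) = x"
    and \<tau>: "\<And>y. y \<in> nbrs E' u \<Longrightarrow> \<tau> y \<in> nbrs E v \<and> \<sigma> (\<tau> y) = y"
begin

abbreviation "SV \<equiv> star_verts V v V' u"
abbreviation "SE \<equiv> star_edges E v E' u \<sigma>"

lemma swap: "star_product V' E' u V E v \<tau> \<sigma>"
  using simple disjoint centre \<sigma> \<tau> by unfold_locales auto

lemma swap_verts: "star_verts V' u V v = SV"
  unfolding star_verts_def by (rule Un_commute)

lemma swap_edges: "star_edges E' u E v \<tau> = SE"
proof -
  have "(\<lambda>y. {y, \<tau> y}) ` nbrs E' u = (\<lambda>x. {x, \<sigma> x}) ` nbrs E v"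
  proof (intro set_eqI iffI)
    fix e assume "e \<in> (\<lambda>y. {y, \<tau> y}) ` nbrs E' u"
    then obtain y where "y \<in> nbrs E' u" "e = {y, \<tau> y}" by blast
    then show "e \<in> (\<lambda>x. {x, \<sigma> x}) ` nbrs E v"
      using \<tau> by (intro image_eqI[of _ _ "\<tau> y"]) auto
  next
    fix e assume "e \<in> (\<lambda>x. {x, \<sigma> x}) ` nbrs E v"
    then obtain x where "x \<in> nbrs E v" "e = {x, \<sigma> x}" by blast
    then show "e \<in> (\<lambda>y. {y, \<tau> y}) ` nbrs E' u"
      using \<sigma> by (intro image_eqI[of _ _ "\<sigma> x"]) auto
  qed
  then show ?thesis unfolding star_edges_def by blast
qed

lemma nbrs_in: "x \<in> nbrs E v \<Longrightarrow> x \<in> V - {v} \<and> \<sigma> x \<in> V' - {u}"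
  using \<sigma>[of x] simple_graph_doubleton[OF simple(1), of x v] simple_graph_doubleton[OF simple(2), of "\<sigma> x" u]
  by (auto simp: nbrs_def)

lemma edge_subset: "e \<in> E \<Longrightarrow> e \<subseteq> V" "e \<in> E' \<Longrightarrow> e \<subseteq> V'"
  using simple_graph_edge[OF simple(1)] simple_graph_edge[OF simple(2)] by blast+

lemma lift_at: "x \<in> nbrs E v \<Longrightarrow> star_lift v \<sigma> {x, v} = {x, \<sigma> x}"
  using nbrs_in[of x] by (auto simp: star_lift_def)

lemma lift_inside: "v \<notin> e \<Longrightarrow> star_lift v \<sigma> e = e"
  by (simp add: star_lift_def)

lemma lift_Int: assumes "e \<in> E" shows "star_lift v \<sigma> e \<inter> V = e - {v}"
proof (cases "v \<in> e")
  case True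
  then obtain x where x: "e = {x, v}" "x \<in> nbrs E v" using simple_graph_edge_at[OF simple(1) assms] by metis
  then show ?thesis using lift_at nbrs_in[OF x(2)] disjoint by auto
next
  case False
  then show ?thesis using edge_subset(1)[OF assms] by (auto simp: lift_inside)
qed

text \<open>The trace of a lifted edge on \<open>V\<close> gives back \<open>e - {v}\<close>, and
  whether \<open>v\<close> belonged to \<open>e\<close> is decided by
  \<open>card e = 2\<close>.\<close>

lemma inj_lift: "inj_on (star_lift v \<sigma>) E"
proof (rule inj_onI)
  fix e f assume ef: "e \<in> E" "f \<in> E" and "star_lift v \<sigma> e = star_lift v \<sigma> f"
  then have eq: "e - {v} = f - {v}" using lift_Int by metis
  have "card e = 2" "card f = 2"
    using simple_graph_edge[OF simple(1)] ef by (metis card_2_iff)+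
  then have "v \<in> e \<longleftrightarrow> v \<in> f"
    using eq by (metis Diff_empty Diff_insert0 card_Diff_singleton diff_Suc_1 numeral_2_eq_2 n_not_Suc_n)
  then show "e = f" using eq by (metis Diff_empty Diff_insert0 insert_Diff)
qed

lemma cross_edges: "(\<lambda>x. {x, \<sigma> x}) ` nbrs E v = star_lift v \<sigma> ` {e \<in> E. v \<in> e}"
proof -
  show ?thesis
    unfolding simple_graph_edges_at[OF simple(1)] image_image using lift_at by (intro image_cong) auto
qed

lemma lift_image: "star_lift v \<sigma> ` E = {e \<in> E. v \<notin> e} \<union> (\<lambda>x. {x, \<sigma> x}) ` nbrs E v"
proof -
  have "star_lift v \<sigma> ` E = star_lift v \<sigma> ` ({e \<in> E. v \<notin> e} \<union> {e \<in> E. v \<in> e})"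
    by (rule arg_cong[where f = "image (star_lift v \<sigma>)"]) blast
  moreover have "star_lift v \<sigma> ` {e \<in> E. v \<notin> e} = {e \<in> E. v \<notin> e}"
    by (simp add: lift_inside cong: image_cong_simp)
  ultimately show ?thesis by (simp only: image_Un cross_edges)
qed

lemma SE_lift: "SE = star_lift v \<sigma> ` E \<union> {e \<in> E'. u \<notin> e}"
  unfolding lift_image star_edges_def by blast

lemma lift_in: "e \<in> E \<Longrightarrow> star_lift v \<sigma> e \<in> SE"
  unfolding SE_lift by blast

lemma SE_cases:
  assumes "e \<in> SE"
  obtains f where "f \<in> E" "e = star_lift v \<sigma> f" | "e \<in> E'" "u \<notin> e" "e \<inter> V = {}" "star_lift u \<tau> e = e"
  using assms edge_subset(2) disjoint unfolding SE_lift by (auto simp: star_lift_def)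

section \<open>Inheritance of the graph properties by star products\<close>

lemma star_simple: "simple_graph SV SE"
  unfolding simple_graph_def
proof (intro conjI ballI)
  show "finite SV" using simple unfolding simple_graph_def star_verts_def by auto
next
  fix e assume "e \<in> SE"
  then consider "e \<in> E" "v \<notin> e" | "e \<in> E'" "u \<notin> e" | x where "x \<in> nbrs E v" "e = {x, \<sigma> x}"
    unfolding star_edges_def by blast
  then show "\<exists>x y. x \<noteq> y \<and> x \<in> SV \<and> y \<in> SV \<and> e = {x, y}"
  proof cases
    case 1
    then show ?thesis using simple_graph_edge[OF simple(1) 1(1)] unfolding star_verts_def
      by (metis DiffI UnI1 insertCI singletonD)
  next
    case 2
    then show ?thesis using simple_graph_edge[OF simple(2) 2(1)] unfolding star_verts_def
      by (metis DiffI UnI2 insertCI singletonD)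
  next
    case 3
    have "x \<in> SV" "\<sigma> x \<in> SV" "x \<noteq> \<sigma> x" using nbrs_in[OF 3(1)] disjoint unfolding star_verts_def by auto
    then show ?thesis using 3(2) by blast
  qed
qed

lemma star_card: "card SV = card V + card V' - 2"
proof -
  have fin: "finite V" "finite V'" using simple unfolding simple_graph_def by auto
  have "card SV = card (V - {v}) + card (V' - {u})"
    unfolding star_verts_def using fin disjoint by (intro card_Un_disjoint) auto
  moreover have "card V > 0" "card V' > 0" using fin centre card_gt_0_iff by blast+
  ultimately show ?thesis using fin centre by simp
qed

text \<open>Lifting is an injection that preserves incidence with every vertex of \<open>V\<close>
  other than \<open>v\<close>, and edges of the other factor do not reach
  \<open>V - {v}\<close>.\<close>

lemma star_degree:
  assumes "x \<in> V - {v}" shows "card {e \<in> SE. x \<in> e} = card {e \<in> E. x \<in> e}"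
proof -
  have mem: "x \<in> star_lift v \<sigma> e \<longleftrightarrow> x \<in> e" if "e \<in> E" for e
    using lift_Int[OF that] assms by blast
  have out: "x \<notin> e" if "e \<in> E'" for e
    using edge_subset(2)[OF that] disjoint assms by blast
  have "{e \<in> SE. x \<in> e} = star_lift v \<sigma> ` {e \<in> E. x \<in> e}"
    using mem out unfolding SE_lift by auto
  then show ?thesis using inj_lift by (simp add: card_image inj_on_subset)
qed

lemma star_cubic:
  assumes "cubic V E" "cubic V' E'" shows "cubic SV SE"
  using assms star_degree star_product.star_degree[OF swap] unfolding cubic_def swap_edges
  by (auto simp: star_verts_def)

lemma star_bipartite:
  assumes "bipartite V E" "bipartite V' E'" shows "bipartite SV SE"
proof -
  obtain A where A: "A \<subseteq> V" "\<And>x y. {x, y} \<in> E \<Longrightarrow> (x \<in> A \<longleftrightarrow> y \<notin> A)"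
    using assms(1) bipartite_iff[OF simple(1)] by blast
  obtain A0 where A0: "A0 \<subseteq> V'" "\<And>x y. {x, y} \<in> E' \<Longrightarrow> (x \<in> A0 \<longleftrightarrow> y \<notin> A0)"
    using assms(2) bipartite_iff[OF simple(2)] by blast
  \<comment> \<open>Exchanging the classes of the second factor if necessary puts \<open>v\<close>
    and \<open>u\<close> into opposite classes. The ends of a cut edge are opposite to
    \<open>v\<close> and to \<open>u\<close>, hence to each other.\<close>
  define B where "B = (if v \<in> A \<longleftrightarrow> u \<in> A0 then V' - A0 else A0)"
  have B: "B \<subseteq> V'" "\<And>x y. {x, y} \<in> E' \<Longrightarrow> (x \<in> B \<longleftrightarrow> y \<notin> B)" "v \<in> A \<longleftrightarrow> u \<notin> B"
    using A0 centre simple_graph_doubleton[OF simple(2)] unfolding B_def by (auto split: if_splits)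
  have "(x \<in> (A \<union> B) \<inter> SV \<longleftrightarrow> y \<notin> (A \<union> B) \<inter> SV)" if xy: "{x, y} \<in> SE" for x y
  proof -
    have SV: "x \<in> SV" "y \<in> SV" using simple_graph_doubleton[OF star_simple xy] by auto
    consider "{x, y} \<in> E" | "{x, y} \<in> E'" | z where "z \<in> nbrs E v" "{x, y} = {z, \<sigma> z}"
      using xy unfolding star_edges_def by blast
    then show ?thesis
    proof cases
      case 1
      then show ?thesis using A B(1) SV disjoint simple_graph_doubleton[OF simple(1) 1] by blast
    next
      case 2
      then show ?thesis using A(1) B SV disjoint simple_graph_doubleton[OF simple(2) 2] by blast
    next
      case 3
      have "{z, v} \<in> E" "{\<sigma> z, u} \<in> E'" using 3(1) \<sigma> by (auto simp: nbrs_def)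
      then have "z \<in> A \<longleftrightarrow> \<sigma> z \<notin> B" using A(2)[of z v] B(2)[of "\<sigma> z" u] B(3) by blast
      moreover have "z \<notin> B" "\<sigma> z \<notin> A" using nbrs_in[OF 3(1)] A(1) B(1) disjoint by blast+
      ultimately show ?thesis using 3(2) SV by (auto simp: doubleton_eq_iff)
    qed
  qed
  then show ?thesis unfolding bipartite_iff[OF star_simple] by blast
qed

text \<open>The connected set \<open>V' - {u}\<close> takes over the role of \<open>v\<close>: a
  path leading to \<open>v\<close> is followed up to the vertex before \<open>v\<close>, where it
  crosses the cut instead.\<close>

lemma star_connected_delete:
  assumes S: "v \<notin> S" "S \<inter> V' = {}" and conV: "connected_on (V - S) E" and conV': "connected_on (V' - {u}) E'"
  shows "connected_on (SV - S) SE"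
proof -
  have W: "SV - S = (V - S - {v}) \<union> (V' - {u})" using S centre unfolding star_verts_def by blast
  obtain r where r: "r \<in> V' - {u}" using conV' unfolding connected_on_def by blast
  have right: "(adj_in (SV - S) SE)\<^sup>*\<^sup>* y r" if "y \<in> V' - {u}" for y
  proof (rule adj_in_mono)
    show "(adj_in (V' - {u}) E')\<^sup>*\<^sup>* y r" using conV' that r unfolding connected_on_adj_in by blast
  qed (auto simp: W star_edges_def)
  have left: "(adj_in (SV - S) SE)\<^sup>*\<^sup>* x r" if "(adj_in (V - S) E)\<^sup>*\<^sup>* x v" "x \<noteq> v" for x
    using that
  proof (induction rule: converse_rtranclp_induct)
    case (step x z)
    have x: "x \<in> SV - S" using step unfolding W adj_in_def by blast
    show ?case
    proof (cases "z = v")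
      case True
      then have n: "x \<in> nbrs E v" using step(1) by (simp add: adj_in_def nbrs_def)
      then have "{x, \<sigma> x} \<in> SE" "\<sigma> x \<in> V' - {u}" using nbrs_in by (auto simp: star_edges_def)
      then have "adj_in (SV - S) SE x (\<sigma> x)" using x unfolding adj_in_def W by blast
      then show ?thesis using right[OF \<open>\<sigma> x \<in> V' - {u}\<close>] by (rule converse_rtranclp_into_rtranclp)
    next
      case False
      then have "adj_in (SV - S) SE x z"
        using step.hyps(1) step.prems unfolding adj_in_def W star_edges_def by auto
      then show ?thesis using step.IH[OF False] by (rule converse_rtranclp_into_rtranclp)
    qed
  qed simp
  show ?thesis
  proof (rule connected_on_root)
    show "r \<in> SV - S" using r W by blast
  next
    fix x assume "x \<in> SV - S"
    then consider "x \<in> V - S" "x \<noteq> v" | "x \<in> V' - {u}" unfolding W by blast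
    then show "(adj_in (SV - S) SE)\<^sup>*\<^sup>* x r"
    proof cases
      case 1
      then show ?thesis using left conV centre S(1) unfolding connected_on_adj_in by blast
    qed (rule right)
  qed
qed

text \<open>Each side has lost two vertices of its factor and is still connected; the cut edge at
  \<open>x\<close> survives and joins the two sides.\<close>

lemma star_connected_delete_both:
  assumes s: "s \<in> V - {v}" and t: "t \<in> V' - {u}"
    and conV: "connected_on (V - {v, s}) E" and conV': "connected_on (V' - {u, t}) E'"
    and x: "x \<in> nbrs E v" "x \<noteq> s" "\<sigma> x \<noteq> t"
  shows "connected_on (SV - {s, t}) SE"
proof -
  have W: "SV - {s, t} = (V - {v, s}) \<union> (V' - {u, t})" using s t disjoint unfolding star_verts_def by blast
  have left: "(adj_in (SV - {s, t}) SE)\<^sup>*\<^sup>* p q" if "p \<in> V - {v, s}" "q \<in> V - {v, s}" for p q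
  proof (rule adj_in_mono)
    show "(adj_in (V - {v, s}) E)\<^sup>*\<^sup>* p q" using conV that unfolding connected_on_adj_in by blast
  qed (auto simp: W star_edges_def)
  have right: "(adj_in (SV - {s, t}) SE)\<^sup>*\<^sup>* p q" if "p \<in> V' - {u, t}" "q \<in> V' - {u, t}" for p q
  proof (rule adj_in_mono)
    show "(adj_in (V' - {u, t}) E')\<^sup>*\<^sup>* p q" using conV' that unfolding connected_on_adj_in by blast
  qed (auto simp: W star_edges_def)
  have xs: "x \<in> V - {v, s}" "\<sigma> x \<in> V' - {u, t}" using nbrs_in[OF x(1)] x by blast+
  then have bridge: "adj_in (SV - {s, t}) SE x (\<sigma> x)"
    using x(1) unfolding adj_in_def W by (auto simp: star_edges_def)
  show ?thesis
  proof (rule connected_on_root)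
    show "\<sigma> x \<in> SV - {s, t}" using xs W by blast
  next
    fix p assume "p \<in> SV - {s, t}"
    then consider "p \<in> V - {v, s}" | "p \<in> V' - {u, t}" unfolding W by blast
    then show "(adj_in (SV - {s, t}) SE)\<^sup>*\<^sup>* p (\<sigma> x)"
    proof cases
      case 1
      show ?thesis using left[OF 1 xs(1)] bridge by (rule rtranclp.rtrancl_into_rtrancl)
    next
      case 2
      then show ?thesis using right xs by blast
    qed
  qed
qed

text \<open>Fewer than three deleted vertices either lie on one side or consist of one vertex on
  each side.\<close>

lemma star_3_connected:
  assumes cubic: "cubic V E" "cubic V' E'" and con: "k_connected 3 V E" "k_connected 3 V' E'"
  shows "k_connected 3 SV SE"
  unfolding k_connected_def
proof (intro conjI allI impI)
  show "3 < card SV" using con star_card unfolding k_connected_def by linarith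
next
  have conV: "connected_on (V - S) E" if "S \<subseteq> V" "card S < 3" for S
    using con(1) that unfolding k_connected_def by blast
  have conV': "connected_on (V' - S) E'" if "S \<subseteq> V'" "card S < 3" for S
    using con(2) that unfolding k_connected_def by blast
  fix S assume S: "S \<subseteq> SV" and c: "card S < 3"
  have fin: "finite S" using S star_simple finite_subset unfolding simple_graph_def by blast
  have vu: "v \<notin> S" "u \<notin> S" using S centre disjoint unfolding star_verts_def by blast+
  have SVV: "S \<subseteq> V \<union> V'" using S unfolding star_verts_def by blast
  consider "S \<inter> V' = {}" | "S \<inter> V = {}" | s t where "s \<in> S \<inter> V" "t \<in> S \<inter> V'" by blast
  then show "connected_on (SV - S) SE"
  proof cases
    case 1
    then show ?thesis
      using star_connected_delete[OF vu(1) 1] conV[of S] conV'[of "{u}"] SVV c centre by auto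
  next
    case 2
    then show ?thesis
      using star_product.star_connected_delete[OF swap vu(2) 2] conV'[of S] conV[of "{v}"] SVV c centre
      unfolding swap_verts swap_edges by auto
  next
    case 3
    have "s \<noteq> t" using 3 disjoint by blast
    then have "S = {s, t}"
      using card_subset_eq[OF fin, of "{s, t}"] card_mono[OF fin, of "{s, t}"] 3 c by auto
    \<comment> \<open>Deleting \<open>s\<close> destroys at most one cut edge, and so does deleting
      \<open>t\<close>, since \<open>\<sigma> x = t\<close> forces \<open>x = \<tau> t\<close>. One
      of the three cut edges is therefore left.\<close>
    have "card {x \<in> nbrs E v. x = s \<or> \<sigma> x = t} \<le> card {s, \<tau> t}"
      by (rule card_mono) (use \<sigma> in auto)
    also have "\<dots> < card (nbrs E v)"
      using card_nbrs_cubic[OF simple(1) cubic(1) centre(1)] card_insert_le_m1[of 3 "{\<tau> t}" s]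
      by (simp add: card_insert_if)
    finally have "{x \<in> nbrs E v. x = s \<or> \<sigma> x = t} \<noteq> nbrs E v" by auto
    then obtain x where "x \<in> nbrs E v" "x \<noteq> s" "\<sigma> x \<noteq> t" by blast
    moreover have "s \<in> V - {v}" "t \<in> V' - {u}" using 3 vu by blast+
    moreover have "card {v, s} < 3" "card {u, t} < 3" by (simp_all add: card_insert_if)
    ultimately show ?thesis
      using star_connected_delete_both[of s t x] conV[of "{v, s}"] conV'[of "{u, t}"] centre \<open>S = {s, t}\<close>
      by auto
  qed
qed

text \<open>As \<open>v\<close> is off the theta subgraph, no edge of the latter changes. In the
  rest, \<open>v\<close> is replaced by the connected set \<open>V' - {u}\<close>, and a link edge
  from \<open>t\<close> to \<open>v\<close> now ends in \<open>\<sigma> t\<close>.\<close>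

lemma star_theta_minor:
  assumes minor: "theta_minor V E ts" and v: "v \<notin> set ts" and con: "connected_on (V' - {u}) E'"
  shows "theta_minor SV SE ts"
proof -
  obtain a b x y p q r where ts: "ts = [a, b, x, y, p, q, r]" "distinct ts" "set ts \<subseteq> V"
    and E8: "{{a, x}, {x, b}, {a, y}, {y, b}, {a, p}, {p, q}, {q, r}, {r, b}} \<subseteq> E"
    and conV: "connected_on (V - set ts) E"
    and link: "\<forall>t\<in>{x, y, p}. \<exists>w\<in>V - set ts. {t, w} \<in> E"
    using minor unfolding theta_minor_def by metis
  have "{{a, x}, {x, b}, {a, y}, {y, b}, {a, p}, {p, q}, {q, r}, {r, b}} \<subseteq> SE"
    using E8 v ts(1) unfolding star_edges_def by auto
  moreover have dis: "set ts \<inter> V' = {}" using ts(3) disjoint by blast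
  then have "connected_on (SV - set ts) SE"
    using star_connected_delete[OF v _ conV con] by blast
  moreover have "set ts \<subseteq> SV" using ts(3) v unfolding star_verts_def by blast
  moreover have "\<exists>w\<in>SV - set ts. {t, w} \<in> SE" if t: "t \<in> {x, y, p}" for t
  proof -
    have tt: "t \<in> set ts" using t ts(1) by auto
    obtain w where w: "w \<in> V - set ts" "{t, w} \<in> E" using link t by blast
    show ?thesis
    proof (cases "w = v")
      case True
      then have "t \<in> nbrs E v" using w by (simp add: nbrs_def)
      then have "{t, \<sigma> t} \<in> SE" "\<sigma> t \<in> SV - set ts"
        using nbrs_in[of t] dis unfolding star_edges_def star_verts_def by auto
      then show ?thesis by blast
    next
      case False
      then have "{t, w} \<in> SE" "w \<in> SV - set ts" using w v tt unfolding star_edges_def star_verts_def by auto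
      then show ?thesis by blast
    qed
  qed
  ultimately show ?thesis unfolding theta_minor_def using ts(1,2) by blast
qed

end

section \<open>Kempe equivalence\<close>

text \<open>Unlike \<open>edge_colorings3\<close>, this does not fix the values outside
  \<open>E\<close>, so colourings can be composed with \<open>star_lift\<close> without restricting
  them again.\<close>

definition proper3 :: "'a set set \<Rightarrow> ('a set \<Rightarrow> nat) \<Rightarrow> bool" where
  "proper3 E c \<longleftrightarrow> (\<forall>e\<in>E. c e \<in> {1, 2, 3}) \<and> (\<forall>e\<in>E. \<forall>f\<in>E. e \<noteq> f \<and> e \<inter> f \<noteq> {} \<longrightarrow> c e \<noteq> c f)"

abbreviation swap_colours :: "nat \<Rightarrow> nat \<Rightarrow> nat \<Rightarrow> nat" where
  "swap_colours \<equiv> Transposition.transpose"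

text \<open>Interchanging \<open>a\<close> and \<open>b\<close> on a set \<open>C\<close> that is a union of Kempe chains; no condition is
  imposed on the colours outside the edge set.\<close>

definition multi_switch :: "'a set set \<Rightarrow> nat \<Rightarrow> nat \<Rightarrow> 'a set set \<Rightarrow> ('a set \<Rightarrow> nat) \<Rightarrow> ('a set \<Rightarrow> nat) \<Rightarrow> bool" where
  "multi_switch E a b C c d \<longleftrightarrow> a \<in> {1, 2, 3} \<and> b \<in> {1, 2, 3} \<and> C \<subseteq> E \<and> (\<forall>e\<in>C. c e \<in> {a, b}) \<and>
     (\<forall>e\<in>C. \<forall>f\<in>E. c f \<in> {a, b} \<and> e \<inter> f \<noteq> {} \<longrightarrow> f \<in> C) \<and>
     (\<forall>e\<in>E. d e = (if e \<in> C then swap_colours a b (c e) else c e))"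

definition switch_avoiding :: "'a set set \<Rightarrow> 'a set set \<Rightarrow> ('a set \<Rightarrow> nat) \<Rightarrow> ('a set \<Rightarrow> nat) \<Rightarrow> bool" where
  "switch_avoiding E U c d \<longleftrightarrow> (\<exists>a b C. multi_switch E a b C c d \<and> C \<inter> U = {})"

definition kempe_connected :: "'a set set \<Rightarrow> bool" where
  "kempe_connected E \<longleftrightarrow> (\<forall>c d. proper3 E c \<longrightarrow> proper3 E d \<longrightarrow> (switch_avoiding E {})\<^sup>*\<^sup>* c d)"

lemma swap_colours_mem: "x \<in> {a, b} \<Longrightarrow> swap_colours a b x \<in> {a, b}"
  by (auto simp: Transposition.transpose_def)

lemma proper3D:
  assumes "proper3 E c"
  shows "e \<in> E \<Longrightarrow> c e \<in> {1, 2, 3}"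
    and "e \<in> E \<Longrightarrow> f \<in> E \<Longrightarrow> e \<noteq> f \<Longrightarrow> e \<inter> f \<noteq> {} \<Longrightarrow> c e \<noteq> c f"
  using assms unfolding proper3_def by blast+

lemma multi_switchD:
  assumes "multi_switch E a b C c d"
  shows "a \<in> {1,2,3}" "b \<in> {1,2,3}" "C \<subseteq> E" "\<And>e. e \<in> C \<Longrightarrow> c e \<in> {a, b}"
    "\<And>e f. e \<in> C \<Longrightarrow> f \<in> E \<Longrightarrow> c f \<in> {a, b} \<Longrightarrow> e \<inter> f \<noteq> {} \<Longrightarrow> f \<in> C"
    "\<And>e. e \<in> E \<Longrightarrow> d e = (if e \<in> C then swap_colours a b (c e) else c e)"
proof -
  note * = assms[unfolded multi_switch_def]
  show "a \<in> {1,2,3}" "b \<in> {1,2,3}" "C \<subseteq> E" using * by - (elim conjE, assumption)+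
  have "\<forall>e\<in>C. c e \<in> {a, b}" using * by (elim conjE)
  then show "\<And>e. e \<in> C \<Longrightarrow> c e \<in> {a, b}" by (rule bspec)
  have "\<forall>e\<in>C. \<forall>f\<in>E. c f \<in> {a, b} \<and> e \<inter> f \<noteq> {} \<longrightarrow> f \<in> C" using * by (elim conjE)
  then show "\<And>e f. e \<in> C \<Longrightarrow> f \<in> E \<Longrightarrow> c f \<in> {a, b} \<Longrightarrow> e \<inter> f \<noteq> {} \<Longrightarrow> f \<in> C" by blast
  have "\<forall>e\<in>E. d e = (if e \<in> C then swap_colours a b (c e) else c e)" using * by (elim conjE)
  then show "\<And>e. e \<in> E \<Longrightarrow> d e = (if e \<in> C then swap_colours a b (c e) else c e)" by (rule bspec)
qed

text \<open>Edges of \<open>C\<close> have colours in \<open>{a, b}\<close> before and after the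
  switch, and an adjacent edge outside \<open>C\<close> has the third colour because
  \<open>C\<close> is closed.\<close>

lemma multi_switch_proper:
  assumes sw: "multi_switch E a b C c d" and c: "proper3 E c" shows "proper3 E d"
proof -
  note ab = multi_switchD(1,2)[OF sw] and CE = multi_switchD(3)[OF sw] and Cab = multi_switchD(4)[OF sw]
    and cl = multi_switchD(5)[OF sw] and d = multi_switchD(6)[OF sw]
  have dC: "d e \<in> {a, b}" if "e \<in> C" for e
    using d[of e] that subsetD[OF CE that] swap_colours_mem[OF Cab[OF that]] by simp
  have mixed: "d e \<noteq> d f" if "e \<in> C" "f \<in> E" "f \<notin> C" "e \<inter> f \<noteq> {}" for e f
    using dC[OF that(1)] cl[OF that(1,2) _ that(4)] that(3) d[OF that(2)] by auto
  show ?thesis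
    unfolding proper3_def
  proof (intro conjI ballI impI)
    fix e assume e: "e \<in> E"
    show "d e \<in> {1, 2, 3}"
    proof (cases "e \<in> C")
      case True then show ?thesis using dC[OF True] ab by blast
    next
      case False then show ?thesis using d[OF e] c e unfolding proper3_def by auto
    qed
  next
    fix e f assume e: "e \<in> E" and f: "f \<in> E" and ne: "e \<noteq> f \<and> e \<inter> f \<noteq> {}"
    then have cc: "c e \<noteq> c f" using c unfolding proper3_def by blast
    consider "e \<in> C" "f \<in> C" | "e \<in> C" "f \<notin> C" | "e \<notin> C" "f \<in> C" | "e \<notin> C" "f \<notin> C" by blast
    then show "d e \<noteq> d f"
    proof cases
      case 1 then show ?thesis using d[OF e] d[OF f] cc by (metis transpose_involutory)
    next
      case 2 then show ?thesis using mixed f ne by blast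
    next
      case 3 then show ?thesis using mixed[of f e] e ne by (metis Int_commute)
    next
      case 4 then show ?thesis using d[OF e] d[OF f] cc by simp
    qed
  qed
qed

lemma switches_proper:
  assumes "(switch_avoiding E U)\<^sup>*\<^sup>* c d" "proper3 E c" shows "proper3 E d"
  using assms by (induction rule: rtranclp_induct) (auto simp: switch_avoiding_def dest: multi_switch_proper)

text \<open>An empty switch links functions that differ only outside \<open>E\<close>; the
  definition leaves room for this by constraining \<open>d\<close> on \<open>E\<close>
  alone.\<close>

lemma switch_avoiding_agree: "\<forall>e\<in>E. d e = c e \<Longrightarrow> switch_avoiding E U c d"
  unfolding switch_avoiding_def multi_switch_def
  by (rule exI[of _ 1], rule exI[of _ 1], rule exI[of _ "{}"]) auto

lemma multi_switch_cong:
  assumes "multi_switch E a b C c d" "\<forall>e\<in>E. c' e = c e" "\<forall>e\<in>E. d' e = d e"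
  shows "multi_switch E a b C c' d'"
proof -
  note sw = multi_switchD[OF assms(1)]
  show ?thesis
    unfolding multi_switch_def
  proof (intro conjI ballI impI)
    fix e assume "e \<in> C" then show "c' e \<in> {a, b}" using sw(3,4) assms(2) by auto
  next
    fix e f assume "e \<in> C" "f \<in> E" "c' f \<in> {a, b} \<and> e \<inter> f \<noteq> {}"
    then show "f \<in> C" using sw(5)[of e f] assms(2) by simp
  next
    fix e assume "e \<in> E"
    then show "d' e = (if e \<in> C then swap_colours a b (c' e) else c' e)" using sw(6)[of e] assms(2,3) by simp
  qed (use sw in auto)
qed

lemma switch_avoiding_sym:
  assumes "switch_avoiding E U c d" shows "switch_avoiding E U d c"
proof -
  obtain a b C where sw: "multi_switch E a b C c d" and av: "C \<inter> U = {}"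
    using assms unfolding switch_avoiding_def by blast
  note ab = multi_switchD(1,2)[OF sw] and CE = multi_switchD(3)[OF sw] and Cab = multi_switchD(4)[OF sw]
    and cl = multi_switchD(5)[OF sw] and d = multi_switchD(6)[OF sw]
  have "multi_switch E a b C d c"
    unfolding multi_switch_def
  proof (intro conjI ballI impI)
    fix e assume e: "e \<in> C"
    then show "d e \<in> {a, b}" using d[of e] subsetD[OF CE e] swap_colours_mem[OF Cab[OF e]] by simp
  next
    fix e f assume "e \<in> C" "f \<in> E" "d f \<in> {a, b} \<and> e \<inter> f \<noteq> {}"
    then show "f \<in> C" using d[of f] cl[of e f] by (cases "f \<in> C") auto
  next
    fix e assume "e \<in> E" then show "c e = (if e \<in> C then swap_colours a b (d e) else d e)"
      using d[of e] by simp
  qed (use ab CE in auto)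
  then show ?thesis using av unfolding switch_avoiding_def by blast
qed

lemma switches_sym:
  assumes "(switch_avoiding E U)\<^sup>*\<^sup>* c d" shows "(switch_avoiding E U)\<^sup>*\<^sup>* d c"
  using assms
  by (induction rule: rtranclp_induct) (auto intro: converse_rtranclp_into_rtranclp switch_avoiding_sym)

lemma switches_mono:
  assumes "(switch_avoiding E U)\<^sup>*\<^sup>* c d" shows "(switch_avoiding E {})\<^sup>*\<^sup>* c d"
proof -
  have "switch_avoiding E U \<le> switch_avoiding E {}" unfolding switch_avoiding_def by blast
  then show ?thesis using assms rtranclp_mono by blast
qed

text \<open>Switching all chains of two colours at once amounts to renaming the colours, so
  colourings that differ by a permutation of colours are equivalent.\<close>

lemma switch_all:
  assumes "a \<in> {1, 2, 3}" "b \<in> {1, 2, 3}"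
  shows "switch_avoiding E {} c (\<lambda>e. swap_colours a b (c e))"
  unfolding switch_avoiding_def multi_switch_def
  by (rule exI[of _ a], rule exI[of _ b], rule exI[of _ "{e \<in> E. c e \<in> {a, b}}"])
    (use assms in \<open>auto simp: Transposition.transpose_def\<close>)

section \<open>From switches of several chains to single Kempe steps and the class count\<close>

lemma edge_colorings3_iff: "c \<in> edge_colorings3 E \<longleftrightarrow> proper3 E c \<and> c \<in> extensional E"
  unfolding edge_colorings3_def proper3_def PiE_def Pi_def by blast

text \<open>A closed set is switched one chain at a time: removing the chain \<open>K\<close> of
  some edge leaves a smaller set that is closed for the new colouring.\<close>

lemma multi_switch_kempe_steps:
  assumes "finite E" "multi_switch E a b C c d" "a \<noteq> b" "c \<in> edge_colorings3 E" "d \<in> edge_colorings3 E"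
  shows "(\<lambda>x y. kempe_step E x y \<or> kempe_step E y x)\<^sup>*\<^sup>* c d"
  using assms
proof (induction "card C" arbitrary: C c rule: less_induct)
  case less
  note sw = less.prems(2) and c = less.prems(4) and d = less.prems(5)
  note ab = multi_switchD(1,2)[OF sw] and CE = multi_switchD(3)[OF sw] and Cab = multi_switchD(4)[OF sw]
    and cl = multi_switchD(5)[OF sw] and de = multi_switchD(6)[OF sw]
  show ?case
  proof (cases "C = {}")
    case True
    then have "c = d" using c d de unfolding edge_colorings3_iff by (metis empty_iff extensionalityI)
    then show ?thesis by simp
  next
    case False
    then obtain e where e: "e \<in> C" by blast
    define K where "K = {f. (ab_adj E c a b)\<^sup>*\<^sup>* e f}"
    have eK: "e \<in> K" unfolding K_def by simp
    have KC: "K \<subseteq> C"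
    proof
      fix f assume "f \<in> K"
      then have "(ab_adj E c a b)\<^sup>*\<^sup>* e f" unfolding K_def by simp
      then show "f \<in> C"
      proof (induction rule: rtranclp_induct)
        case (step f g) then show ?case using cl[of f g] unfolding ab_adj_def by blast
      qed (rule e)
    qed
    have Kcl: "g \<in> K" if "f \<in> K" "g \<in> E" "c g \<in> {a, b}" "f \<inter> g \<noteq> {}" for f g
    proof -
      have "ab_adj E c a b f g" using that KC CE Cab unfolding ab_adj_def by blast
      then show ?thesis using that(1) unfolding K_def by (auto intro: rtranclp.rtrancl_into_rtrancl)
    qed
    define c1 where "c1 = kempe_switch c a b K"
    have c1: "c1 f = (if f \<in> K then swap_colours a b (c f) else c f)" for f
      unfolding c1_def kempe_switch_def Transposition.transpose_def by simp
    have "kempe_chain E c a b K" unfolding kempe_chain_def K_def using e CE Cab by blast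
    then have step: "kempe_step E c c1" unfolding kempe_step_def c1_def using ab less.prems(3) by blast
    have "multi_switch E a b K c c1"
      unfolding multi_switch_def
    proof (intro conjI ballI impI)
      fix f g assume "f \<in> K" "g \<in> E" "c g \<in> {a, b} \<and> f \<inter> g \<noteq> {}"
      then show "g \<in> K" using Kcl by blast
    next
      fix f assume "f \<in> K" then show "c f \<in> {a, b}" using KC Cab by blast
    next
      fix f show "c1 f = (if f \<in> K then swap_colours a b (c f) else c f)" by (rule c1)
    qed (use ab KC CE in auto)
    then have "proper3 E c1" using c multi_switch_proper unfolding edge_colorings3_iff by blast
    moreover have "c1 \<in> extensional E"
      using c KC CE c1 unfolding edge_colorings3_iff extensional_def by auto
    ultimately have c1c: "c1 \<in> edge_colorings3 E" unfolding edge_colorings3_iff by blast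
    have "multi_switch E a b (C - K) c1 d"
      unfolding multi_switch_def
    proof (intro conjI ballI impI)
      fix f assume "f \<in> C - K" then show "c1 f \<in> {a, b}" using c1 Cab by simp
    next
      fix f g assume fg: "f \<in> C - K" "g \<in> E" "c1 g \<in> {a, b} \<and> f \<inter> g \<noteq> {}"
      \<comment> \<open>If \<open>g\<close> were in \<open>K\<close>, then so would be
        \<open>f\<close>. Hence \<open>g\<close> has kept its colour and closedness of
        \<open>C\<close> applies to it.\<close>
      have "g \<notin> K" using Kcl[of g f] fg CE Cab by blast
      then show "g \<in> C - K" using cl[of f g] c1[of g] fg by simp
    next
      fix f assume "f \<in> E"
      then show "d f = (if f \<in> C - K then swap_colours a b (c1 f) else c1 f)"
        using de[of f] c1[of f] KC by auto
    qed (use ab CE in auto)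
    moreover have "card (C - K) < card C"
      using e eK CE less.prems(1) by (intro psubset_card_mono) (auto intro: finite_subset)
    ultimately have "(\<lambda>x y. kempe_step E x y \<or> kempe_step E y x)\<^sup>*\<^sup>* c1 d"
      using less.hyps less.prems(1,3) c1c d by blast
    then show ?thesis by (rule converse_rtranclp_into_rtranclp[rotated]) (use step in blast)
  qed
qed

lemma switches_kempe_steps:
  assumes "finite E" "(switch_avoiding E {})\<^sup>*\<^sup>* c d" "proper3 E c"
  shows "(\<lambda>x y. kempe_step E x y \<or> kempe_step E y x)\<^sup>*\<^sup>* (restrict c E) (restrict d E)"
  using assms(2)
proof (induction rule: rtranclp_induct)
  case (step d d')
  obtain a b C where sw: "multi_switch E a b C d d'" using step(2) unfolding switch_avoiding_def by blast
  have pr: "proper3 E d" using switches_proper step(1) assms(3) by blast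
  then have pr': "proper3 E d'" using multi_switch_proper sw by blast
  have col: "restrict g E \<in> edge_colorings3 E" if "proper3 E g" for g
    using that unfolding edge_colorings3_iff proper3_def by auto
  have sw': "multi_switch E a b C (restrict d E) (restrict d' E)"
    by (rule multi_switch_cong[OF sw]) auto
  have "(\<lambda>x y. kempe_step E x y \<or> kempe_step E y x)\<^sup>*\<^sup>* (restrict d E) (restrict d' E)"
  proof (cases "a = b")
    case True
    then have "restrict d E = restrict d' E" using sw unfolding multi_switch_def by (intro restrict_ext) auto
    then show ?thesis by simp
  next
    case False
    show ?thesis by (rule multi_switch_kempe_steps[OF assms(1) sw' False col[OF pr] col[OF pr']])
  qed
  with step.IH show ?case by (rule rtranclp_trans)
qed simp

text \<open>Connectedness makes all colourings equivalent; the colouring \<open>c\<close> ensures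
  that there is a class at all.\<close>

lemma kempe_connected_K_edge3:
  assumes fin: "finite E" and con: "kempe_connected E" and ex: "proper3 E c"
  shows "K_edge3 V E = 1"
proof -
  have "kempe_equiv E = edge_colorings3 E \<times> edge_colorings3 E"
  proof -
    have "(\<lambda>x y. kempe_step E x y \<or> kempe_step E y x)\<^sup>*\<^sup>* c d"
      if cd: "c \<in> edge_colorings3 E" "d \<in> edge_colorings3 E" for c d
    proof -
      have "(switch_avoiding E {})\<^sup>*\<^sup>* c d" "proper3 E c"
        using con cd unfolding kempe_connected_def edge_colorings3_iff by blast+
      moreover have "restrict c E = c" "restrict d E = d"
        using cd unfolding edge_colorings3_iff by (auto simp: extensional_restrict)
      ultimately show ?thesis using switches_kempe_steps[OF fin, of c d] by simp
    qed
    then show ?thesis unfolding kempe_equiv_def by blast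
  qed
  moreover have "restrict c E \<in> edge_colorings3 E"
    using ex unfolding edge_colorings3_iff proper3_def by auto
  ultimately have "edge_colorings3 E // kempe_equiv E = {edge_colorings3 E}"
    unfolding quotient_def by auto
  then show ?thesis unfolding K_edge3_def by simp
qed

section \<open>Kempe equivalence in star products\<close>

text \<open>Properness except at \<open>u\<close>, where colours may repeat. This is all that a
  colouring of the star product gives for a factor at first, because the edges at the deleted vertex
  turn into pairwise disjoint cut edges.\<close>

definition semi_proper3 :: "'a set set \<Rightarrow> 'a \<Rightarrow> ('a set \<Rightarrow> nat) \<Rightarrow> bool" where
  "semi_proper3 E u c \<longleftrightarrow> (\<forall>e\<in>E. c e \<in> {1, 2, 3}) \<and>
     (\<forall>e\<in>E. \<forall>f\<in>E. e \<noteq> f \<and> e \<inter> f - {u} \<noteq> {} \<longrightarrow> c e \<noteq> c f)"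

text \<open>The first clause is the parity lemma for the 3-edge cut around \<open>u\<close>; the second one moves
  between colourings without touching that cut.\<close>

definition kempe_gadget :: "'a set set \<Rightarrow> 'a \<Rightarrow> bool" where
  "kempe_gadget E u \<longleftrightarrow> (\<forall>c. semi_proper3 E u c \<longrightarrow> proper3 E c) \<and>
     (\<forall>c d. proper3 E c \<longrightarrow> proper3 E d \<longrightarrow> (\<forall>e\<in>E. u \<in> e \<longrightarrow> c e = d e) \<longrightarrow>
       (switch_avoiding E {e. u \<in> e})\<^sup>*\<^sup>* c d)"

lemma colours_at_bij:
  assumes "simple_graph V E" "cubic V E" "v \<in> V" "proper3 E c"
  shows "bij_betw (\<lambda>x. c {x, v}) (nbrs E v) {1, 2, 3}"
proof -
  have inj: "inj_on (\<lambda>x. c {x, v}) (nbrs E v)"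
  proof (rule inj_onI, rule ccontr)
    fix x y assume xy: "x \<in> nbrs E v" "y \<in> nbrs E v" "c {x, v} = c {y, v}" "x \<noteq> y"
    then have "{x, v} \<noteq> {y, v}" by (auto simp: doubleton_eq_iff)
    then have "c {x, v} \<noteq> c {y, v}"
      using xy(1,2) by (intro proper3D(2)[OF assms(4)]) (auto simp: nbrs_def)
    then show False using xy(3) by blast
  qed
  have "(\<lambda>x. c {x, v}) ` nbrs E v \<subseteq> {1, 2, 3}"
    using proper3D(1)[OF assms(4)] by (intro image_subsetI) (auto simp: nbrs_def)
  moreover have "card ((\<lambda>x. c {x, v}) ` nbrs E v) = 3"
    using card_image[OF inj] card_nbrs_cubic[OF assms(1-3)] by simp
  ultimately have "(\<lambda>x. c {x, v}) ` nbrs E v = {1, 2, 3}"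
    by (intro card_subset_eq) auto
  with inj show ?thesis unfolding bij_betw_def by blast
qed

text \<open>A renaming of colours makes two colourings agree at \<open>u\<close>, after which the
  gadget property applies. This gives the first graph of the family its Kempe connectedness.\<close>

lemma kempe_gadget_connected:
  assumes "simple_graph V E" "cubic V E" "u \<in> V" and gad: "kempe_gadget E u"
  shows "kempe_connected E"
  unfolding kempe_connected_def
proof (intro allI impI)
  fix c d assume c: "proper3 E c" and d: "proper3 E d"
  obtain x y z where n: "nbrs E u = {x, y, z}" and ne: "x \<noteq> y" "x \<noteq> z" "y \<noteq> z"
    using card_nbrs_cubic[OF assms(1-3)] by (metis card_3_iff)
  have E: "{x, u} \<in> E" "{y, u} \<in> E" "{z, u} \<in> E" using n unfolding nbrs_def by auto
  have distinct_at: "g {x, u} \<in> {1,2,3}" "g {y, u} \<in> {1,2,3}" "g {z, u} \<in> {1,2,3}" "g {x, u} \<noteq> g {y, u}"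
    "g {x, u} \<noteq> g {z, u}" "g {y, u} \<noteq> g {z, u}" if "proper3 E g" for g
  proof -
    note b = colours_at_bij[OF assms(1-3) that]
    have "x \<in> nbrs E u" "y \<in> nbrs E u" "z \<in> nbrs E u" using n by auto
    note mem = this
    show "g {x, u} \<in> {1,2,3}" "g {y, u} \<in> {1,2,3}" "g {z, u} \<in> {1,2,3}"
      using mem[THEN bij_betw_apply[OF b]] .
    show "g {x, u} \<noteq> g {y, u}" "g {x, u} \<noteq> g {z, u}" "g {y, u} \<noteq> g {z, u}"
      using bij_betw_imp_inj_on[OF b] mem ne by (auto dest: inj_onD)
  qed
  have sum6: "g {x, u} + g {y, u} + g {z, u} = 6" if "proper3 E g" for g
    using distinct_at[OF that] by auto
  define c1 where "c1 = (\<lambda>e. swap_colours (c {x, u}) (d {x, u}) (c e))"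
  have s1: "switch_avoiding E {} c c1"
    unfolding c1_def using distinct_at(1)[OF c] distinct_at(1)[OF d] by (rule switch_all)
  then have c1: "proper3 E c1" using c switches_proper by blast
  have x1: "c1 {x, u} = d {x, u}" unfolding c1_def by simp
  \<comment> \<open>Both \<open>c1 {y, u}\<close> and \<open>d {y, u}\<close> differ from
    \<open>d {x, u}\<close>, so this transposition preserves the agreement at \<open>x\<close>. The
    colour of the third edge is then forced by the sum 1 + 2 + 3 = 6.\<close>
  define c2 where "c2 = (\<lambda>e. swap_colours (c1 {y, u}) (d {y, u}) (c1 e))"
  have s2: "switch_avoiding E {} c1 c2"
    unfolding c2_def using distinct_at(2)[OF c1] distinct_at(2)[OF d] by (rule switch_all)
  then have c2: "proper3 E c2" using c1 switches_proper by blast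
  have x2: "c2 {x, u} = d {x, u}" "c2 {y, u} = d {y, u}"
    using x1 distinct_at(4)[OF c1] distinct_at(4)[OF d] unfolding c2_def by (auto simp: Transposition.transpose_def)
  then have "c2 {z, u} = d {z, u}" using sum6[OF c2] sum6[OF d] by simp
  moreover have "e \<in> {{x, u}, {y, u}, {z, u}}" if e: "e \<in> E" "u \<in> e" for e
  proof -
    obtain w where "e = {w, u}" "w \<in> nbrs E u" using simple_graph_edge_at[OF assms(1) e] .
    then show ?thesis using n by auto
  qed
  ultimately have "\<forall>e\<in>E. u \<in> e \<longrightarrow> c2 e = d e" using x2 by blast
  then have "(switch_avoiding E {e. u \<in> e})\<^sup>*\<^sup>* c2 d" using gad c2 d unfolding kempe_gadget_def by blast
  then have "(switch_avoiding E {})\<^sup>*\<^sup>* c2 d" by (rule switches_mono)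
  then show "(switch_avoiding E {})\<^sup>*\<^sup>* c d"
    using s1 s2 by (meson converse_rtranclp_into_rtranclp)
qed

section \<open>Transfer of colourings and switches between the factors and the star product\<close>

context star_product
begin

lemma lift_meet:
  assumes "e \<in> E" "f \<in> E" "star_lift v \<sigma> e \<inter> star_lift v \<sigma> f \<noteq> {}" shows "e \<inter> f \<noteq> {}"
proof -
  obtain z where z: "z \<in> star_lift v \<sigma> e" "z \<in> star_lift v \<sigma> f" using assms(3) by blast
  show ?thesis
  proof (cases "z \<in> V")
    case True then show ?thesis using z lift_Int assms by blast
  next
    case False
    then have "v \<in> e" "v \<in> f" using z edge_subset(1) assms lift_inside by blast+
    then show ?thesis by blast
  qed
qed

text \<open>The vertex \<open>v\<close> has to be excluded: two different edges that meet only there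
  are lifted to disjoint cut edges.\<close>

lemma lift_meet_away:
  assumes "e \<in> E" "f \<in> E" "e \<inter> f - {v} \<noteq> {}" shows "star_lift v \<sigma> e \<inter> star_lift v \<sigma> f \<noteq> {}"
  using lift_Int assms by blast

lemma lift_meet_other:
  assumes "e \<in> E" "f \<in> E'" "star_lift v \<sigma> e \<inter> f \<noteq> {}" shows "v \<in> e"
  using assms edge_subset disjoint lift_inside[of e] by blast

lemma lift_not_other:
  assumes "e \<in> E" "f \<in> E'" shows "star_lift v \<sigma> e \<noteq> f"
proof -
  obtain x y where "e = {x, y}" "x \<noteq> y" using simple_graph_edge[OF simple(1) assms(1)] .
  then have "e - {v} \<noteq> {}" by auto
  then show ?thesis using lift_Int[OF assms(1)] edge_subset(2)[OF assms(2)] disjoint by blast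
qed

text \<open>A cut edge is a lift from either factor; through this identity, colour information
  passes from one side to the other.\<close>

lemma lift_cross: "x \<in> nbrs E v \<Longrightarrow> star_lift v \<sigma> {x, v} = star_lift u \<tau> {\<sigma> x, u}"
  using lift_at[of x] star_product.lift_at[OF swap, of "\<sigma> x"] \<sigma>[of x] by auto

lemma semi_proper_pullback:
  assumes "proper3 SE c" shows "semi_proper3 E v (c \<circ> star_lift v \<sigma>)"
  unfolding semi_proper3_def
proof (intro conjI ballI impI)
  fix e assume "e \<in> E" then show "(c \<circ> star_lift v \<sigma>) e \<in> {1, 2, 3}"
    using assms lift_in unfolding proper3_def by simp
next
  fix e f assume ef: "e \<in> E" "f \<in> E" "e \<noteq> f \<and> e \<inter> f - {v} \<noteq> {}"
  then have "star_lift v \<sigma> e \<noteq> star_lift v \<sigma> f" using inj_lift unfolding inj_on_def by blast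
  moreover have "star_lift v \<sigma> e \<inter> star_lift v \<sigma> f \<noteq> {}" using lift_meet_away ef by blast
  ultimately show "(c \<circ> star_lift v \<sigma>) e \<noteq> (c \<circ> star_lift v \<sigma>) f"
    using assms ef lift_in unfolding proper3_def by simp
qed

text \<open>The gadget turns semi-properness at \<open>u\<close> into properness, so the cut edges
  have distinct colours. By \<open>lift_cross\<close> these are also the colours of the edges at
  \<open>v\<close>.\<close>

lemma proper_pullback:
  assumes c: "proper3 SE c" and gad: "kempe_gadget E' u"
  shows "proper3 E' (c \<circ> star_lift u \<tau>)" "proper3 E (c \<circ> star_lift v \<sigma>)"
proof -
  show P: "proper3 E' (c \<circ> star_lift u \<tau>)"
    using star_product.semi_proper_pullback[OF swap] c gad unfolding swap_edges kempe_gadget_def by blast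
  have semi: "semi_proper3 E v (c \<circ> star_lift v \<sigma>)" by (rule semi_proper_pullback[OF c])
  show "proper3 E (c \<circ> star_lift v \<sigma>)"
    unfolding proper3_def
  proof (intro conjI ballI impI)
    fix e assume "e \<in> E" then show "(c \<circ> star_lift v \<sigma>) e \<in> {1, 2, 3}"
      using semi unfolding semi_proper3_def by blast
  next
    fix e f assume e: "e \<in> E" and f: "f \<in> E" and ne: "e \<noteq> f \<and> e \<inter> f \<noteq> {}"
    show "(c \<circ> star_lift v \<sigma>) e \<noteq> (c \<circ> star_lift v \<sigma>) f"
    proof (cases "e \<inter> f - {v} = {}")
      case False
      then show ?thesis using semi e f ne unfolding semi_proper3_def by blast
    next
      case True
      then have "v \<in> e" "v \<in> f" using ne by blast+
      then obtain x y where x: "e = {x, v}" "x \<in> nbrs E v" and y: "f = {y, v}" "y \<in> nbrs E v"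
        using simple_graph_edge_at[OF simple(1)] e f by metis
      have "\<sigma> x \<noteq> \<sigma> y" using \<sigma>[OF x(2)] \<sigma>[OF y(2)] x y ne by metis
      then have "{\<sigma> x, u} \<noteq> {\<sigma> y, u}" by (auto simp: doubleton_eq_iff)
      moreover have "{\<sigma> x, u} \<in> E'" "{\<sigma> y, u} \<in> E'" using \<sigma> x y by (auto simp: nbrs_def)
      ultimately have "(c \<circ> star_lift u \<tau>) {\<sigma> x, u} \<noteq> (c \<circ> star_lift u \<tau>) {\<sigma> y, u}"
        by (intro proper3D(2)[OF P]) auto
      then show ?thesis using lift_cross x y by simp
    qed
  qed
qed

text \<open>A switch touching the edges at \<open>v\<close> is continued by interchanging the two colours on the
  whole other side.\<close>

lemma switch_lift:
  assumes sw: "multi_switch E a b C (c \<circ> star_lift v \<sigma>) d"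
  shows "\<exists>c'. switch_avoiding SE {} c c' \<and> (\<forall>e\<in>E. c' (star_lift v \<sigma> e) = d e)"
proof -
  note ab = multi_switchD(1,2)[OF sw] and CE = multi_switchD(3)[OF sw] and Cab = multi_switchD(4)[OF sw, unfolded comp_apply]
    and cl = multi_switchD(5)[OF sw, unfolded comp_apply] and d = multi_switchD(6)[OF sw, unfolded comp_apply]
  \<comment> \<open>Once the cut is involved, all gadget edges coloured \<open>a\<close> or
    \<open>b\<close> are taken, whether or not their chain reaches the cut. This makes closedness on
    the gadget side immediate.\<close>
  define D where "D = {f \<in> E'. u \<notin> f \<and> c f \<in> {a, b} \<and> (\<exists>e\<in>C. v \<in> e)}"
  define C' where "C' = star_lift v \<sigma> ` C \<union> D"
  define c' where "c' = (\<lambda>e. if e \<in> C' then swap_colours a b (c e) else c e)"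
  have lift_C': "star_lift v \<sigma> e \<in> C' \<longleftrightarrow> e \<in> C" if "e \<in> E" for e
  proof -
    have "star_lift v \<sigma> e \<notin> D" using lift_not_other[OF that] unfolding D_def by blast
    then show ?thesis using inj_lift that CE unfolding C'_def by (auto dest: inj_onD)
  qed
  have "multi_switch SE a b C' c c'"
    unfolding multi_switch_def
  proof (intro conjI ballI impI)
    show "C' \<subseteq> SE" using CE unfolding C'_def D_def SE_lift by blast
  next
    fix e assume "e \<in> C'" then show "c e \<in> {a, b}" using Cab unfolding C'_def D_def by blast
  next
    fix e f assume e: "e \<in> C'" and f: "f \<in> SE" and ef: "c f \<in> {a, b} \<and> e \<inter> f \<noteq> {}"
    show "f \<in> C'"
      using f
    proof (cases rule: SE_cases)
      case (1 g)
      consider h where "h \<in> C" "e = star_lift v \<sigma> h" | h where "e \<in> E'" "h \<in> C" "v \<in> h"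
        using e unfolding C'_def D_def by blast
      then have "g \<in> C"
      proof cases
        case (1 h)
        then have "h \<inter> g \<noteq> {}" using lift_meet[of h g] CE ef \<open>g \<in> E\<close> \<open>f = star_lift v \<sigma> g\<close> by blast
        then show ?thesis using cl[of h g] 1 ef \<open>g \<in> E\<close> \<open>f = star_lift v \<sigma> g\<close> by blast
      next
        case (2 h)
        \<comment> \<open>The cut edges of \<open>g\<close> and \<open>h\<close> may be disjoint,
          but \<open>g\<close> and \<open>h\<close> meet in \<open>v\<close>, so closedness of
          \<open>C\<close> in the factor applies.\<close>
        then have "v \<in> g" using lift_meet_other[of g e] ef \<open>g \<in> E\<close> \<open>f = star_lift v \<sigma> g\<close> by blast
        then show ?thesis using cl[of h g] 2 ef \<open>g \<in> E\<close> \<open>f = star_lift v \<sigma> g\<close> by blast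
      qed
      then show ?thesis using 1 unfolding C'_def by blast
    next
      case 2
      have "\<exists>h\<in>C. v \<in> h"
      proof (cases "e \<in> D")
        case False
        then obtain h where h: "h \<in> C" "e = star_lift v \<sigma> h" using e unfolding C'_def by blast
        then have "h \<in> E" "star_lift v \<sigma> h \<inter> f \<noteq> {}" using CE ef by auto
        then have "v \<in> h" using lift_meet_other[of h f] 2(1) by simp
        then show ?thesis using h(1) by blast
      qed (auto simp: D_def)
      then show ?thesis using 2 ef unfolding C'_def D_def by blast
    qed
  next
    fix e show "c' e = (if e \<in> C' then swap_colours a b (c e) else c e)" unfolding c'_def by (rule refl)
  qed (use ab in auto)
  moreover have "c' (star_lift v \<sigma> e) = d e" if "e \<in> E" for e
    unfolding c'_def using lift_C'[OF that] d[OF that] by simp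
  ultimately show ?thesis unfolding switch_avoiding_def by blast
qed

text \<open>Away from \<open>v\<close> the edges are their own lifts, and no edge off the cut
  acquires new neighbours on its own side, so the same set \<open>C\<close> can be switched. It is
  applied with the factors exchanged, to repair the gadget without touching the old graph.\<close>

lemma switch_lift_avoiding:
  assumes sw: "multi_switch E a b C (c \<circ> star_lift v \<sigma>) d" and av: "C \<inter> {e. v \<in> e} = {}"
  shows "\<exists>c'. switch_avoiding SE {} c c' \<and> (\<forall>e\<in>E. c' (star_lift v \<sigma> e) = d e) \<and>
    (\<forall>e\<in>E'. c' (star_lift u \<tau> e) = c (star_lift u \<tau> e))"
proof -
  note ab = multi_switchD(1,2)[OF sw] and CE = multi_switchD(3)[OF sw] and Cab = multi_switchD(4)[OF sw, unfolded comp_apply]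
    and cl = multi_switchD(5)[OF sw, unfolded comp_apply] and d = multi_switchD(6)[OF sw, unfolded comp_apply]
  have fixC: "star_lift v \<sigma> e = e" if "e \<in> C" for e using that av lift_inside by blast
  define c' where "c' = (\<lambda>e. if e \<in> C then swap_colours a b (c e) else c e)"
  have lift_C: "star_lift v \<sigma> e \<in> C \<longleftrightarrow> e \<in> C" if "e \<in> E" for e
    using fixC inj_lift that CE by (metis inj_onD subsetD)
  have "multi_switch SE a b C c c'"
    unfolding multi_switch_def
  proof (intro conjI ballI impI)
    show "C \<subseteq> SE" using CE av unfolding star_edges_def by blast
  next
    fix e assume "e \<in> C" then show "c e \<in> {a, b}" using Cab[of e] fixC[of e] by simp
  next
    fix e f assume e: "e \<in> C" and f: "f \<in> SE" and ef: "c f \<in> {a, b} \<and> e \<inter> f \<noteq> {}"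
    show "f \<in> C"
      using f
    proof (cases rule: SE_cases)
      case (1 g)
      then have "e \<inter> g \<noteq> {}" using lift_meet[of e g] e CE ef fixC[OF e] by auto
      then show ?thesis using cl[of e g] 1 e ef lift_C[of g] by blast
    next
      case 2
      then show ?thesis using e CE edge_subset(1) ef by blast
    qed
  next
    fix e show "c' e = (if e \<in> C then swap_colours a b (c e) else c e)" unfolding c'_def by (rule refl)
  qed (use ab in auto)
  moreover have "c' (star_lift v \<sigma> e) = d e" if "e \<in> E" for e
    unfolding c'_def using lift_C[OF that] d[OF that] by simp
  moreover have "c' (star_lift u \<tau> e) = c (star_lift u \<tau> e)" if "e \<in> E'" for e
    unfolding c'_def using star_product.lift_not_other[OF swap that] CE by auto
  ultimately show ?thesis unfolding switch_avoiding_def by blast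
qed

lemma switches_lift:
  assumes "(switch_avoiding E {})\<^sup>*\<^sup>* (c \<circ> star_lift v \<sigma>) g"
  shows "\<exists>c'. (switch_avoiding SE {})\<^sup>*\<^sup>* c c' \<and> (\<forall>e\<in>E. c' (star_lift v \<sigma> e) = g e)"
  using assms
proof (induction rule: rtranclp_induct)
  case base
  then show ?case by (intro exI[of _ c]) simp
next
  case (step g h)
  obtain c' where c': "(switch_avoiding SE {})\<^sup>*\<^sup>* c c'" "\<forall>e\<in>E. c' (star_lift v \<sigma> e) = g e"
    using step.IH by blast
  obtain a b C where "multi_switch E a b C g h" using step(2) unfolding switch_avoiding_def by blast
  then have "multi_switch E a b C (c' \<circ> star_lift v \<sigma>) h"
    by (rule multi_switch_cong) (use c' in auto)
  from switch_lift[OF this] show ?case using c'(1) by (meson rtranclp.rtrancl_into_rtrancl)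
qed

lemma switches_lift_avoiding:
  assumes "(switch_avoiding E {e. v \<in> e})\<^sup>*\<^sup>* (c \<circ> star_lift v \<sigma>) g"
  shows "\<exists>c'. (switch_avoiding SE {})\<^sup>*\<^sup>* c c' \<and> (\<forall>e\<in>E. c' (star_lift v \<sigma> e) = g e) \<and>
    (\<forall>e\<in>E'. c' (star_lift u \<tau> e) = c (star_lift u \<tau> e))"
  using assms
proof (induction rule: rtranclp_induct)
  case base
  then show ?case by (intro exI[of _ c]) simp
next
  case (step g h)
  obtain c' where c': "(switch_avoiding SE {})\<^sup>*\<^sup>* c c'" "\<forall>e\<in>E. c' (star_lift v \<sigma> e) = g e"
    "\<forall>e\<in>E'. c' (star_lift u \<tau> e) = c (star_lift u \<tau> e)"
    using step.IH by blast
  obtain a b C where sw: "multi_switch E a b C g h" and av: "C \<inter> {e. v \<in> e} = {}"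
    using step(2) unfolding switch_avoiding_def by blast
  have "multi_switch E a b C (c' \<circ> star_lift v \<sigma>) h"
    by (rule multi_switch_cong[OF sw]) (use c' in auto)
  from switch_lift_avoiding[OF this av] obtain c'' where
    "switch_avoiding SE {} c' c''" "\<forall>e\<in>E. c'' (star_lift v \<sigma> e) = h e"
    "\<forall>e\<in>E'. c'' (star_lift u \<tau> e) = c' (star_lift u \<tau> e)" by blast
  then show ?case using c' by (intro exI[of _ c'']) auto
qed

text \<open>The order matters: correcting the old side may disturb the gadget, whereas the later
  correction of the gadget preserves the old side and the cut.\<close>

theorem star_kempe_connected:
  assumes con: "kempe_connected E" and gad: "kempe_gadget E' u"
  shows "kempe_connected SE"
  unfolding kempe_connected_def
proof (intro allI impI)
  fix c d assume c: "proper3 SE c" and d: "proper3 SE d"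
  note pc = proper_pullback[OF c gad] and pd = proper_pullback[OF d gad]
  obtain c1 where c1: "(switch_avoiding SE {})\<^sup>*\<^sup>* c c1"
    and c1d: "\<forall>e\<in>E. c1 (star_lift v \<sigma> e) = (d \<circ> star_lift v \<sigma>) e"
    using switches_lift con pc(2) pd(2) unfolding kempe_connected_def by blast
  have "proper3 SE c1" using switches_proper c c1 by blast
  note p1 = proper_pullback[OF this gad]
  have "(c1 \<circ> star_lift u \<tau>) e = (d \<circ> star_lift u \<tau>) e" if e: "e \<in> E'" "u \<in> e" for e
  proof -
    obtain y where y: "e = {y, u}" "y \<in> nbrs E' u" using simple_graph_edge_at[OF simple(2) e] .
    then have "star_lift u \<tau> e = star_lift v \<sigma> {\<tau> y, v}"
      using lift_cross[of "\<tau> y"] \<tau>[of y] by simp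
    moreover have "{\<tau> y, v} \<in> E" using \<tau>[OF y(2)] by (simp add: nbrs_def)
    ultimately show ?thesis using c1d by simp
  qed
  then have "(switch_avoiding E' {e. u \<in> e})\<^sup>*\<^sup>* (c1 \<circ> star_lift u \<tau>) (d \<circ> star_lift u \<tau>)"
    using gad p1(1) pd(1) unfolding kempe_gadget_def by blast
  from star_product.switches_lift_avoiding[OF swap this]
  obtain c2 where c2: "(switch_avoiding SE {})\<^sup>*\<^sup>* c1 c2"
    and c2d: "\<forall>e\<in>E'. c2 (star_lift u \<tau> e) = d (star_lift u \<tau> e)"
    and c2c: "\<forall>e\<in>E. c2 (star_lift v \<sigma> e) = c1 (star_lift v \<sigma> e)"
    unfolding swap_edges by auto
  have "d e = c2 e" if "e \<in> SE" for e
    using that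
  proof (cases rule: SE_cases)
    case (1 f) then show ?thesis using c1d c2c by simp
  next
    case 2 then show ?thesis using c2d by metis
  qed
  then have "switch_avoiding SE {} c2 d" by (intro switch_avoiding_agree) simp
  then show "(switch_avoiding SE {})\<^sup>*\<^sup>* c d"
    using c1 c2 by (meson rtranclp.rtrancl_into_rtrancl rtranclp_trans)
qed

lemma star_proper3:
  assumes c: "proper3 E c" and c': "proper3 E' c'" and m: "\<And>x. x \<in> nbrs E v \<Longrightarrow> c {x, v} = c' {\<sigma> x, u}"
  shows "\<exists>g. proper3 SE g"
proof -
  define g where "g e = (if e \<in> star_lift v \<sigma> ` E then c (inv_into E (star_lift v \<sigma>) e) else c' e)" for e
  have gl: "g (star_lift v \<sigma> e) = c e" if "e \<in> E" for e
    unfolding g_def using that inj_lift by simp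
  have gr: "g e = c' e" if "e \<in> E'" for e
    unfolding g_def using lift_not_other[OF _ that] by auto
  have mixed: "g (star_lift v \<sigma> e) \<noteq> g f"
    if ef: "e \<in> E" "f \<in> E'" "u \<notin> f" "star_lift v \<sigma> e \<inter> f \<noteq> {}" for e f
  proof -
    obtain x where x: "e = {x, v}" "x \<in> nbrs E v"
      using simple_graph_edge_at[OF simple(1) ef(1) lift_meet_other[OF ef(1,2,4)]] .
    have sx: "{\<sigma> x, u} \<in> E'" using \<sigma>[OF x(2)] by (simp add: nbrs_def)
    have "star_lift u \<tau> {\<sigma> x, u} \<inter> star_lift u \<tau> f \<noteq> {}"
      using ef(3,4) lift_cross[OF x(2)] x(1) by (simp add: star_lift_def)
    \<comment> \<open>As \<open>f\<close> avoids \<open>u\<close>, it is its own lift, and the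
      conflict between a cut edge and \<open>f\<close> can be examined inside the second
      factor.\<close>
    then have "{\<sigma> x, u} \<inter> f \<noteq> {}" using star_product.lift_meet[OF swap sx ef(2)] by blast
    moreover have "{\<sigma> x, u} \<noteq> f" using ef(3) by blast
    ultimately have "c' {\<sigma> x, u} \<noteq> c' f" using proper3D(2)[OF c' sx ef(2)] by blast
    then show ?thesis using gl[OF ef(1)] gr[OF ef(2)] m[OF x(2)] x(1) by simp
  qed
  have "proper3 SE g"
    unfolding proper3_def
  proof (intro conjI ballI impI)
    fix e assume "e \<in> SE"
    then show "g e \<in> {1, 2, 3}"
    proof (cases rule: SE_cases)
      case (1 f) then show ?thesis using gl[of f] c unfolding proper3_def by simp
    next
      case 2 then show ?thesis using gr[of e] c' unfolding proper3_def by simp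
    qed
  next
    fix e f assume e: "e \<in> SE" and f: "f \<in> SE" and ne: "e \<noteq> f \<and> e \<inter> f \<noteq> {}"
    show "g e \<noteq> g f"
      using e
    proof (cases rule: SE_cases)
      case (1 e0)
      note e0 = this
      show ?thesis
        using f
      proof (cases rule: SE_cases)
        case (1 f0)
        then have "e0 \<inter> f0 \<noteq> {}" "e0 \<noteq> f0" using lift_meet[of e0 f0] e0 ne by auto
        then have "c e0 \<noteq> c f0" using proper3D(2)[OF c] e0 1 by blast
        then show ?thesis using gl e0 1 by simp
      next
        case 2
        then show ?thesis using mixed[of e0 f] e0 ne by blast
      qed
    next
      case 2
      note e2 = this
      show ?thesis
        using f
      proof (cases rule: SE_cases)
        case (1 f0)
        then have "g f \<noteq> g e" using mixed[of f0 e] e2 ne by blast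
        then show ?thesis by simp
      next
        case 2
        then show ?thesis using gr e2 ne proper3D(2)[OF c', of e f] by simp
      qed
    qed
  qed
  then show ?thesis by blast
qed

end

section \<open>The Franklin graph\<close>

text \<open>The bipartition classes are \<open>{0..5}\<close> and \<open>{6..11}\<close>, and the deleted vertex \<open>u\<close> is 11. Colourings are lists
  aligned with the list of edges.\<close>

definition franklin :: "(nat \<times> nat) list" where
  "franklin = [(0, 6), (0, 7), (0, 8), (1, 6), (1, 7), (1, 9), (2, 6), (2, 10), (2, 11),
     (3, 7), (3, 10), (3, 11), (4, 8), (4, 9), (4, 10), (5, 8), (5, 9), (5, 11)]"

text \<open>Comparing components separately is enough: first ends are below 6 and second ends are
  not.\<close>

definition meets :: "nat \<times> nat \<Rightarrow> nat \<times> nat \<Rightarrow> bool" where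
  "meets p q \<longleftrightarrow> fst p = fst q \<or> snd p = snd q"

definition meets_off :: "nat \<Rightarrow> nat \<times> nat \<Rightarrow> nat \<times> nat \<Rightarrow> bool" where
  "meets_off u p q \<longleftrightarrow> fst p = fst q \<or> (snd p = snd q \<and> snd p \<noteq> u)"

text \<open>With \<open>u = 11\<close> the colours at that vertex may repeat, so the list covers the
  semi-proper colourings and not only the proper ones.\<close>

fun colourings :: "nat \<Rightarrow> (nat \<times> nat) list \<Rightarrow> nat list list" where
  "colourings u [] = [[]]"
| "colourings u (p # ps) = concat (map (\<lambda>cs. map (\<lambda>x. x # cs)
     (filter (\<lambda>x. list_all (\<lambda>(q, y). y = x \<longrightarrow> \<not> meets_off u p q) (zip ps cs)) [1, 2, 3])) (colourings u ps))"

definition switchable :: "nat \<times> nat \<Rightarrow> (nat \<times> nat) list \<Rightarrow> nat list \<Rightarrow> bool" where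
  "switchable ab m cs \<longleftrightarrow> list_all (\<lambda>(p, x). if p \<in> set m then x = fst ab \<or> x = snd ab
     else x = fst ab \<or> x = snd ab \<longrightarrow> list_all (\<lambda>q. \<not> meets p q) m) (zip franklin cs)"

definition switch_list :: "nat \<times> nat \<Rightarrow> (nat \<times> nat) list \<Rightarrow> nat list \<Rightarrow> nat list" where
  "switch_list ab m cs = map (\<lambda>(p, x). if p \<in> set m then Transposition.transpose (fst ab) (snd ab) x else x) (zip franklin cs)"

text \<open>Each list \<open>ms\<close> is a stage at which one candidate may be switched or the
  stage may be skipped; this keeps the search tree small.\<close>

fun reachable :: "(nat \<times> nat) list list list \<Rightarrow> nat list \<Rightarrow> nat list list" where
  "reachable [] cs = [cs]"
| "reachable (ms # mss) cs = reachable mss cs @ concat (map (\<lambda>(m, ab).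
     if switchable ab m cs then reachable mss (switch_list ab m cs) else [])
     (List.product ms [(1, 2), (1, 3), (2, 3)]))"

text \<open>Six cycles that occur as Kempe chains: every colouring reaches its normal form by switching
  at most one of the four hexagons and then a subset of the two squares.\<close>

definition chains :: "(nat \<times> nat) list list list" where
  "chains =
    [[[(1, 6), (1, 9), (2, 6), (2, 10), (4, 9), (4, 10)], [(1, 7), (1, 9), (3, 7), (3, 10), (4, 9), (4, 10)],
      [(0, 7), (0, 8), (3, 7), (3, 10), (4, 8), (4, 10)], [(0, 6), (0, 8), (2, 6), (2, 10), (4, 8), (4, 10)]],
     [[(0, 6), (0, 7), (1, 6), (1, 7)]], [[(4, 8), (4, 9), (5, 8), (5, 9)]]]"

text \<open>One representative for each colour pattern \<open>x\<close>, \<open>y\<close>,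
  \<open>z\<close> on the edges from 2, 3 and 5 to vertex 11.\<close>

definition normal_form :: "nat \<Rightarrow> nat \<Rightarrow> nat \<Rightarrow> nat list" where
  "normal_form x y z = [x, y, z, y, x, z, z, y, x, z, x, y, x, y, z, y, x, z]"

text \<open>Positions 8, 11 and 17 are those of the edges at vertex 11.\<close>

definition normalizes :: "nat list \<Rightarrow> bool" where
  "normalizes cs \<longleftrightarrow> (let x = cs ! 8; y = cs ! 11; z = cs ! 17 in
     x \<noteq> y \<and> x \<noteq> z \<and> y \<noteq> z \<and> normal_form x y z \<in> set (reachable chains cs))"

text \<open>This single evaluation provides both clauses of \<open>kempe_gadget\<close>: distinct
  colours at 11 for semi-proper colourings, and a route to a normal form determined by these
  colours.\<close>

lemma all_normalize: "list_all normalizes (colourings 11 franklin)"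
  by code_simp

section \<open>Connectivity by evaluation\<close>

fun spread :: "nat list \<Rightarrow> (nat \<times> nat) list \<Rightarrow> nat list \<Rightarrow> nat list" where
  "spread R [] vis = vis"
| "spread R ((i, j) # ps) vis =
     (if i \<in> set R \<or> j \<in> set R then spread R ps vis
      else if i \<in> set vis then (if j \<in> set vis then spread R ps vis else spread R ps (j # vis))
      else if j \<in> set vis then spread R ps (i # vis) else spread R ps vis)"

definition covers :: "nat list \<Rightarrow> nat list \<Rightarrow> bool" where
  "covers R vis \<longleftrightarrow> list_all (\<lambda>x. x \<in> set R \<or> x \<in> set vis) [0..<12]"

text \<open>Every vertex set \<open>R\<close> used below misses 0, 1 or 2, and two passes over the edges suffice.\<close>

definition connected_without :: "nat list \<Rightarrow> bool" where
  "connected_without R \<longleftrightarrow>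
     list_ex (\<lambda>r. r \<notin> set R \<and> covers R (spread R (franklin @ franklin) [r])) [0, 1, 2]"

lemma connected_without_theta: "connected_without [0, 1, 6, 7, 8, 4, 9]" by code_simp
text \<open>The diagonal \<open>i = j\<close> takes care of deleting a single vertex.\<close>

lemma connected_without_pairs: "list_all (\<lambda>i. list_all (\<lambda>j. connected_without [i, j]) [0..<12]) [0..<12]"
  by code_simp

definition franklin_verts :: "(nat \<Rightarrow> 'a) \<Rightarrow> 'a set" where
  "franklin_verts f = f ` {..<12}"

definition franklin_edge :: "(nat \<Rightarrow> 'a) \<Rightarrow> nat \<times> nat \<Rightarrow> 'a set" where
  "franklin_edge f p = {f (fst p), f (snd p)}"

definition franklin_edges :: "(nat \<Rightarrow> 'a) \<Rightarrow> 'a set set" where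
  "franklin_edges f = franklin_edge f ` set franklin"

lemma franklin_bounds: "p \<in> set franklin \<Longrightarrow> fst p < 6 \<and> 6 \<le> snd p \<and> snd p < 12"
  by (auto simp: franklin_def)

text \<open>The graph is copied along an arbitrary injection, because every step of the construction
  needs a copy disjoint from the graph built so far.\<close>

locale franklin_graph =
  fixes f :: "nat \<Rightarrow> 'a"
  assumes inj_f: "inj f"
begin

abbreviation "FV \<equiv> franklin_verts f"
abbreviation "FE \<equiv> franklin_edges f"

lemma edge_iff: "e \<in> FE \<longleftrightarrow> (\<exists>p\<in>set franklin. e = {f (fst p), f (snd p)})"
  unfolding franklin_edges_def franklin_edge_def by blast

lemma mem_edge: "f k \<in> franklin_edge f p \<longleftrightarrow> k = fst p \<or> k = snd p"
  using inj_f unfolding franklin_edge_def by (auto dest: injD)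

lemma inj_edge: "inj_on (franklin_edge f) (set franklin)"
proof (rule inj_onI)
  fix p q assume pq: "p \<in> set franklin" "q \<in> set franklin" "franklin_edge f p = franklin_edge f q"
  have "fst p = fst q \<or> fst p = snd q" "snd p = fst q \<or> snd p = snd q"
    using pq(3) mem_edge by (metis)+
  then show "p = q"
    using franklin_bounds[OF pq(1)] franklin_bounds[OF pq(2)] by (auto simp: prod_eq_iff)
qed

lemma edges_meet:
  assumes "p \<in> set franklin" "q \<in> set franklin"
  shows "franklin_edge f p \<inter> franklin_edge f q \<noteq> {} \<longleftrightarrow> meets p q"
    and "franklin_edge f p \<inter> franklin_edge f q - {f 11} \<noteq> {} \<longleftrightarrow> meets_off 11 p q"
proof -
  have *: "(\<exists>k. f k \<in> franklin_edge f p \<and> f k \<in> franklin_edge f q \<and> P k) \<longleftrightarrow>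
      fst p = fst q \<and> P (fst p) \<or> snd p = snd q \<and> P (snd p)" for P
    unfolding mem_edge using franklin_bounds[OF assms(1)] franklin_bounds[OF assms(2)] by auto
  have ex: "franklin_edge f p \<inter> franklin_edge f q \<inter> S \<noteq> {} \<longleftrightarrow>
      (\<exists>k. f k \<in> franklin_edge f p \<and> f k \<in> franklin_edge f q \<and> f k \<in> S)" for S
    unfolding franklin_edge_def by blast
  show "franklin_edge f p \<inter> franklin_edge f q \<noteq> {} \<longleftrightarrow> meets p q"
    using ex[of UNIV] *[of "\<lambda>_. True"] by (simp add: meets_def)
  have "franklin_edge f p \<inter> franklin_edge f q - {f 11} \<noteq> {} \<longleftrightarrow>
      (\<exists>k. f k \<in> franklin_edge f p \<and> f k \<in> franklin_edge f q \<and> k \<noteq> 11)"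
    using ex[of "- {f 11}"] inj_f by (simp add: Diff_eq inj_eq)
  then show "franklin_edge f p \<inter> franklin_edge f q - {f 11} \<noteq> {} \<longleftrightarrow> meets_off 11 p q"
    using *[of "\<lambda>k. k \<noteq> 11"] franklin_bounds[OF assms(1)] by (simp add: meets_off_def)
qed

lemma franklin_simple: "simple_graph FV FE"
  unfolding simple_graph_def
proof (intro conjI ballI)
  show "finite FV" by (simp add: franklin_verts_def)
next
  fix e assume "e \<in> FE"
  then obtain p where p: "p \<in> set franklin" "e = {f (fst p), f (snd p)}" unfolding edge_iff by blast
  then have "fst p \<noteq> snd p" "fst p < 12" "snd p < 12" using franklin_bounds[OF p(1)] by auto
  then show "\<exists>u v. u \<noteq> v \<and> u \<in> FV \<and> v \<in> FV \<and> e = {u, v}"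
    using p(2) inj_f unfolding franklin_verts_def by (intro exI[of _ "f (fst p)"] exI[of _ "f (snd p)"]) (auto simp: inj_eq)
qed

lemma card_FV: "card FV = 12"
  using card_image[OF inj_on_subset[OF inj_f subset_UNIV], of "{..<12}"] by (simp add: franklin_verts_def)

lemma franklin_cubic: "cubic FV FE"
  unfolding cubic_def
proof
  fix v assume "v \<in> FV"
  then obtain k where k: "k < 12" "v = f k" unfolding franklin_verts_def by blast
  let ?P = "{p \<in> set franklin. k = fst p \<or> k = snd p}"
  have "{e \<in> FE. v \<in> e} = franklin_edge f ` ?P"
    unfolding franklin_edges_def k(2) using mem_edge by blast
  then have "card {e \<in> FE. v \<in> e} = card ?P"
    using card_image[OF inj_on_subset[OF inj_edge, of ?P]] by auto
  also have "?P = set (filter (\<lambda>p. k = fst p \<or> k = snd p) franklin)" by auto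
  also have "card \<dots> = 3"
  proof -
    have "list_all (\<lambda>k. length (remdups (filter (\<lambda>p. k = fst p \<or> k = snd p) franklin)) = 3) [0..<12]"
      by code_simp
    then show ?thesis using k(1) unfolding list_all_iff length_remdups_card_conv by auto
  qed
  finally show "card {e \<in> FE. v \<in> e} = 3" .
qed

lemma franklin_bipartite: "bipartite FV FE"
  unfolding bipartite_iff[OF franklin_simple]
proof (intro exI[of _ "f ` {..<6}"] conjI allI impI)
  show "f ` {..<6} \<subseteq> FV" unfolding franklin_verts_def by auto
next
  fix x y assume "{x, y} \<in> FE"
  then obtain p where p: "p \<in> set franklin" "{x, y} = {f (fst p), f (snd p)}" unfolding edge_iff by blast
  have "f (fst p) \<in> f ` {..<6}" "f (snd p) \<notin> f ` {..<6}"
    using franklin_bounds[OF p(1)] inj_f by (auto simp: inj_image_mem_iff)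
  then show "(x \<in> f ` {..<6}) = (y \<notin> f ` {..<6})"
    using p(2) by (metis doubleton_eq_iff)
qed

text \<open>Only one direction is proved: every visited vertex is joined to the root off
  \<open>R\<close>. That all vertices are visited is checked by evaluation through
  \<open>covers\<close>.\<close>

lemma spread_sound:
  fixes R r
  defines "Q \<equiv> \<lambda>x. x < 12 \<and> x \<notin> set R \<and> (adj_in (FV - f ` set R) FE)\<^sup>*\<^sup>* (f x) (f r)"
  assumes "set ps \<subseteq> set franklin" "\<forall>x\<in>set vis. Q x"
  shows "\<forall>x\<in>set (spread R ps vis). Q x"
  using assms(2,3)
proof (induction ps arbitrary: vis)
  case (Cons p ps)
  obtain i j where p: "p = (i, j)" by (cases p)
  have ij: "i < 12" "j < 12" "{f i, f j} \<in> FE"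
    using Cons.prems(1) franklin_bounds[of p] unfolding p edge_iff by force+
  have IH: "\<forall>x\<in>set (spread R ps vis'). Q x" if "\<forall>x\<in>set vis'. Q x" for vis'
    using Cons.IH Cons.prems(1) that by simp
  have grow: "Q y" if "Q x" "y < 12" "y \<notin> set R" "{f y, f x} \<in> FE" for x y
  proof -
    have "adj_in (FV - f ` set R) FE (f y) (f x)"
      using that inj_f unfolding adj_in_def Q_def franklin_verts_def by (auto simp: inj_image_mem_iff)
    then show ?thesis using that unfolding Q_def by (meson converse_rtranclp_into_rtranclp)
  qed
  have "{f j, f i} \<in> FE" using ij(3) by (simp add: insert_commute)
  note grow1 = grow[of j i] and grow2 = grow[of i j]
  show ?case
    unfolding p spread.simps
    using Cons.prems(2) ij \<open>{f j, f i} \<in> FE\<close> grow1 grow2 by (auto intro!: IH split: if_splits)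
qed simp

lemma connected_without_sound:
  assumes "connected_without R" shows "connected_on (FV - f ` set R) FE"
proof -
  obtain r where r: "r \<in> set [0, 1, 2]" "r \<notin> set R" "covers R (spread R (franklin @ franklin) [r])"
    using assms unfolding connected_without_def list_ex_iff by blast
  have r12: "r < 12" using r(1) by auto
  have all: "\<forall>x\<in>set (spread R (franklin @ franklin) [r]).
      x < 12 \<and> x \<notin> set R \<and> (adj_in (FV - f ` set R) FE)\<^sup>*\<^sup>* (f x) (f r)"
    by (rule spread_sound) (use r(2) r12 in auto)
  show ?thesis
  proof (rule connected_on_root)
    show "f r \<in> FV - f ` set R"
      using r(2) r12 inj_f unfolding franklin_verts_def by (auto simp: inj_image_mem_iff)
  next
    fix v assume "v \<in> FV - f ` set R"
    then obtain x where x: "x < 12" "v = f x" "x \<notin> set R" unfolding franklin_verts_def by blast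
    then have "x \<in> set (spread R (franklin @ franklin) [r])"
      using r(3) unfolding covers_def list_all_iff by auto
    then show "(adj_in (FV - f ` set R) FE)\<^sup>*\<^sup>* v (f r)" using all x(2) by blast
  qed
qed

lemma franklin_3_connected: "k_connected 3 FV FE"
  unfolding k_connected_def
proof (intro conjI allI impI)
  show "3 < card FV" by (simp add: card_FV)
next
  have two: "connected_on (FV - f ` {i, j}) FE" if "i < 12" "j < 12" for i j
    using connected_without_sound[of "[i, j]"] connected_without_pairs that
    unfolding list_all_iff by simp
  fix S assume S: "S \<subseteq> FV" "card S < 3"
  obtain T where T: "T \<subseteq> {..<12}" "S = f ` T" using S(1) unfolding franklin_verts_def by (rule subset_imageE)
  have "card T < 3" using S(2) card_image[OF inj_on_subset[OF inj_f subset_UNIV], of T] T(2) by simp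
  moreover have "finite T" using T(1) finite_subset by blast
  ultimately consider "T = {}" | i where "T = {i}" | i j where "T = {i, j}"
    by (metis card_1_singletonE card_2_iff card_0_eq less_Suc_eq numeral_3_eq_3 less_one numeral_2_eq_2 One_nat_def)
  then show "connected_on (FV - S) FE"
  proof cases
    case 1
    have "connected_without []" by code_simp
    then show ?thesis using connected_without_sound[of "[]"] T(2) 1 by simp
  next
    case (2 i)
    then show ?thesis using two[of i i] T by auto
  next
    case (3 i j)
    then show ?thesis using two[of i j] T by auto
  qed
qed

text \<open>The branch vertices 0 and 1 have the common neighbours 6 and 7, and the third path is
  0-8-4-9-1. The remaining vertices 2, 3, 5, 10, 11 are connected and attached by the edges 6-2, 7-3
  and 8-5.\<close>

lemma franklin_theta_minor: "theta_minor FV FE (map f [0, 1, 6, 7, 8, 4, 9])"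
proof -
  let ?ks = "[0, 1, 6, 7, 8, 4, 9] :: nat list"
  have E: "{f i, f j} \<in> FE" if "(i, j) \<in> set franklin \<or> (j, i) \<in> set franklin" for i j
    using that unfolding edge_iff by (auto simp: insert_commute bexI[of _ "(i, j)"] bexI[of _ "(j, i)"])
  have "connected_on (FV - f ` set ?ks) FE"
    by (rule connected_without_sound) (rule connected_without_theta)
  then have con: "connected_on (FV - set (map f ?ks)) FE" by simp
  have W: "f k \<in> FV - set (map f ?ks)" if "k < 12" "k \<notin> set ?ks" for k
    using that inj_f unfolding franklin_verts_def by (auto simp: inj_eq)
  show ?thesis
    unfolding theta_minor_def
  proof (rule exI[of _ "f 0"], rule exI[of _ "f 1"], rule exI[of _ "f 6"], rule exI[of _ "f 7"],
      rule exI[of _ "f 8"], rule exI[of _ "f 4"], rule exI[of _ "f 9"], intro conjI con)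
    show "distinct (map f ?ks)" using inj_f by (simp add: inj_eq)
    show "set (map f ?ks) \<subseteq> FV" unfolding franklin_verts_def by auto
    show "{{f 0, f 6}, {f 6, f 1}, {f 0, f 7}, {f 7, f 1}, {f 0, f 8}, {f 8, f 4}, {f 4, f 9}, {f 9, f 1}} \<subseteq> FE"
      by (simp add: E franklin_def)
    have "{f 6, f 2} \<in> FE" "{f 7, f 3} \<in> FE" "{f 8, f 5} \<in> FE" by (simp_all add: E franklin_def)
    then show "\<forall>t\<in>{f 6, f 7, f 8}. \<exists>w\<in>FV - set (map f ?ks). {t, w} \<in> FE"
      using W[of 2] W[of 3] W[of 5] by auto
  qed simp
qed

lemma colourings_complete:
  assumes "distinct ps" "\<And>p. p \<in> set ps \<Longrightarrow> g p \<in> {1, 2, 3}"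
    and "\<And>p q. p \<in> set ps \<Longrightarrow> q \<in> set ps \<Longrightarrow> p \<noteq> q \<Longrightarrow> meets_off u p q \<Longrightarrow> g p \<noteq> g q"
  shows "map g ps \<in> set (colourings u ps)"
  using assms
proof (induction ps)
  case (Cons p ps)
  have "map g ps \<in> set (colourings u ps)" using Cons by simp
  moreover have "\<not> meets_off u p q" if "(q, y) \<in> set (zip ps (map g ps))" "y = g p" for q y
  proof -
    have "q \<in> set ps" "y = g q" using that(1) by (auto simp: zip_map2 zip_same_conv_map)
    then show ?thesis using Cons.prems(1) Cons.prems(3)[of p q] that(2) by auto
  qed
  ultimately show ?case using Cons.prems(2)[of p] by (auto simp: list_all_iff)
qed simp

section \<open>Soundness of the computed switches and the gadget property\<close>

definition represents :: "('a set \<Rightarrow> nat) \<Rightarrow> nat list \<Rightarrow> bool" where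
  "represents c cs \<longleftrightarrow> cs = map (\<lambda>p. c (franklin_edge f p)) franklin"

lemma zip_represents: "represents c cs \<Longrightarrow> zip franklin cs = map (\<lambda>p. (p, c (franklin_edge f p))) franklin"
  unfolding represents_def by (simp add: zip_map2 zip_same_conv_map)

lemma represents_inj: "represents c cs \<Longrightarrow> represents d cs \<Longrightarrow> e \<in> FE \<Longrightarrow> c e = d e"
  unfolding represents_def franklin_edges_def by auto

lemma switchable_sound:
  assumes rep: "represents c cs" and sw: "switchable ab m cs"
    and ab: "fst ab \<in> {1, 2, 3}" "snd ab \<in> {1, 2, 3}"
    and m: "set m \<subseteq> set franklin" "\<forall>p\<in>set m. snd p \<noteq> 11"
  shows "\<exists>d. switch_avoiding FE {e. f 11 \<in> e} c d \<and> represents d (switch_list ab m cs)"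
proof -
  define a b where "a = fst ab" and "b = snd ab"
  define C where "C = franklin_edge f ` set m"
  define d where "d e = (if e \<in> C then swap_colours a b (c e) else c e)" for e
  have memC: "franklin_edge f p \<in> C \<longleftrightarrow> p \<in> set m" if "p \<in> set franklin" for p
    using inj_edge m(1) that unfolding C_def by (auto dest: inj_onD)
  have valid: "if p \<in> set m then c (franklin_edge f p) \<in> {a, b}
      else c (franklin_edge f p) \<in> {a, b} \<longrightarrow> (\<forall>q\<in>set m. \<not> meets p q)" if "p \<in> set franklin" for p
    using sw that unfolding switchable_def zip_represents[OF rep] list_all_iff a_def b_def by auto
  have "multi_switch FE a b C c d"
    unfolding multi_switch_def
  proof (intro conjI ballI impI)
    show "C \<subseteq> FE" using m(1) unfolding C_def franklin_edges_def by blast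
  next
    fix e assume "e \<in> C"
    then obtain p where "p \<in> set m" "e = franklin_edge f p" unfolding C_def by blast
    then show "c e \<in> {a, b}" using valid[of p] m(1) by auto
  next
    fix e e' assume e: "e \<in> C" and e': "e' \<in> FE" and meet: "c e' \<in> {a, b} \<and> e \<inter> e' \<noteq> {}"
    obtain p where p: "p \<in> set m" "e = franklin_edge f p" using e unfolding C_def by blast
    obtain q where q: "q \<in> set franklin" "e' = franklin_edge f q" using e' unfolding franklin_edges_def by blast
    have "meets q p"
      using edges_meet(1)[OF q(1), of p] meet p q m(1) by (auto simp: Int_commute)
    then have "q \<in> set m" using valid[OF q(1)] meet p(1) q(2) by (auto split: if_splits)
    then show "e' \<in> C" using q(2) unfolding C_def by blast
  next
    fix e show "d e = (if e \<in> C then swap_colours a b (c e) else c e)" by (rule d_def)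
  qed (use ab a_def b_def in auto)
  moreover have "C \<inter> {e. f 11 \<in> e} = {}"
  proof -
    have "f 11 \<notin> franklin_edge f p" if "p \<in> set m" for p
      using franklin_bounds[of p] m that unfolding mem_edge by force
    then show ?thesis unfolding C_def by blast
  qed
  moreover have "represents d (switch_list ab m cs)"
    unfolding represents_def switch_list_def zip_represents[OF rep]
    using memC by (auto simp: d_def a_def b_def)
  ultimately show ?thesis unfolding switch_avoiding_def by blast
qed

lemma reachable_sound:
  assumes "cs' \<in> set (reachable mss cs)" "represents c cs"
    and "\<forall>ms\<in>set mss. \<forall>m\<in>set ms. set m \<subseteq> set franklin \<and> (\<forall>p\<in>set m. snd p \<noteq> 11)"
  shows "\<exists>d. (switch_avoiding FE {e. f 11 \<in> e})\<^sup>*\<^sup>* c d \<and> represents d cs'"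
  using assms
proof (induction mss arbitrary: c cs)
  case Nil
  then show ?case by auto
next
  case (Cons ms mss)
  consider "cs' \<in> set (reachable mss cs)"
    | m ab where "m \<in> set ms" "ab \<in> {(1, 2), (1, 3), (2, 3)}" "switchable ab m cs"
        "cs' \<in> set (reachable mss (switch_list ab m cs))"
    using Cons.prems(1) by (auto split: if_splits)
  then show ?case
  proof cases
    case 1
    then show ?thesis using Cons.IH Cons.prems(2,3) by simp
  next
    case (2 m ab)
    have ab: "fst ab \<in> {1, 2, 3}" "snd ab \<in> {1, 2, 3}" using 2(2) by auto
    have m: "set m \<subseteq> set franklin" "\<forall>p\<in>set m. snd p \<noteq> 11" using Cons.prems(3) 2(1) by auto
    obtain c1 where c1: "switch_avoiding FE {e. f 11 \<in> e} c c1" "represents c1 (switch_list ab m cs)"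
      using switchable_sound[OF Cons.prems(2) 2(3) ab m] by blast
    obtain d where "(switch_avoiding FE {e. f 11 \<in> e})\<^sup>*\<^sup>* c1 d" "represents d cs'"
      using Cons.IH[OF 2(4) c1(2)] Cons.prems(3) by auto
    then show ?thesis using c1(1) by (meson converse_rtranclp_into_rtranclp)
  qed
qed

lemma semi_proper_normalizes:
  assumes "semi_proper3 FE (f 11) c"
  shows "normalizes (map (\<lambda>p. c (franklin_edge f p)) franklin)"
proof -
  have "map (\<lambda>p. c (franklin_edge f p)) franklin \<in> set (colourings 11 franklin)"
  proof (rule colourings_complete)
    show "distinct franklin" by (simp add: franklin_def)
  next
    fix p assume "p \<in> set franklin"
    then show "c (franklin_edge f p) \<in> {1, 2, 3}"
      using assms unfolding semi_proper3_def franklin_edges_def by blast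
  next
    fix p q assume pq: "p \<in> set franklin" "q \<in> set franklin" "p \<noteq> q" "meets_off 11 p q"
    then have "franklin_edge f p \<noteq> franklin_edge f q" using inj_edge by (auto dest: inj_onD)
    moreover have "franklin_edge f p \<inter> franklin_edge f q - {f 11} \<noteq> {}" using edges_meet(2) pq by blast
    moreover have "franklin_edge f p \<in> FE" "franklin_edge f q \<in> FE" using pq unfolding franklin_edges_def by auto
    ultimately show "c (franklin_edge f p) \<noteq> c (franklin_edge f q)"
      using assms unfolding semi_proper3_def by blast
  qed
  then show ?thesis using all_normalize unfolding list_all_iff by blast
qed

text \<open>Two colourings that agree at \<open>f 11\<close> reach the same normal form, since it
  depends only on the colours there; one of the two routes is then reversed.\<close>

lemma franklin_gadget: "kempe_gadget FE (f 11)"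
  unfolding kempe_gadget_def
proof (intro conjI allI impI)
  fix c assume semi: "semi_proper3 FE (f 11) c"
  have dist: "c (franklin_edge f (2, 11)) \<noteq> c (franklin_edge f (3, 11))"
    "c (franklin_edge f (2, 11)) \<noteq> c (franklin_edge f (5, 11))"
    "c (franklin_edge f (3, 11)) \<noteq> c (franklin_edge f (5, 11))"
    using semi_proper_normalizes[OF semi] by (simp_all add: normalizes_def Let_def franklin_def)
  show "proper3 FE c"
    unfolding proper3_def
  proof (intro conjI ballI impI)
    fix e assume "e \<in> FE" then show "c e \<in> {1, 2, 3}" using semi unfolding semi_proper3_def by blast
  next
    fix e e' assume e: "e \<in> FE" and e': "e' \<in> FE" and ne: "e \<noteq> e' \<and> e \<inter> e' \<noteq> {}"
    show "c e \<noteq> c e'"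
    proof (cases "e \<inter> e' - {f 11} = {}")
      case False
      then show ?thesis using semi e e' ne unfolding semi_proper3_def by blast
    next
      case True
      have at: "g \<in> {franklin_edge f (2, 11), franklin_edge f (3, 11), franklin_edge f (5, 11)}"
        if g: "g \<in> FE" "f 11 \<in> g" for g
      proof -
        obtain p where p: "p \<in> set franklin" "g = franklin_edge f p" using g(1) unfolding franklin_edges_def by blast
        then have "11 = fst p \<or> 11 = snd p" using g(2) mem_edge by blast
        then have "p \<in> {(2, 11), (3, 11), (5, 11)}" using p(1) by (auto simp: franklin_def)
        then show ?thesis using p(2) by blast
      qed
      have "f 11 \<in> e" "f 11 \<in> e'" using True ne by blast+
      then show ?thesis using at[OF e] at[OF e'] ne dist by auto
    qed
  qed
next
  fix c d assume c: "proper3 FE c" and d: "proper3 FE d" and agree: "\<forall>e\<in>FE. f 11 \<in> e \<longrightarrow> c e = d e"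
  let ?nf = "\<lambda>g. normal_form (g (franklin_edge f (2, 11))) (g (franklin_edge f (3, 11))) (g (franklin_edge f (5, 11)))"
  have chains: "\<forall>ms\<in>set chains. \<forall>m\<in>set ms. set m \<subseteq> set franklin \<and> (\<forall>p\<in>set m. snd p \<noteq> 11)"
    by (simp add: chains_def franklin_def)
  have reach: "\<exists>h. (switch_avoiding FE {e. f 11 \<in> e})\<^sup>*\<^sup>* g h \<and> represents h (?nf g)" if g: "proper3 FE g" for g
  proof -
    have "semi_proper3 FE (f 11) g" using g unfolding semi_proper3_def proper3_def by blast
    then have "?nf g \<in> set (reachable chains (map (\<lambda>p. g (franklin_edge f p)) franklin))"
      using semi_proper_normalizes[of g] unfolding normalizes_def Let_def by (simp add: franklin_def)
    then show ?thesis by (rule reachable_sound[OF _ _ chains]) (simp add: represents_def)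
  qed
  obtain c1 where c1: "(switch_avoiding FE {e. f 11 \<in> e})\<^sup>*\<^sup>* c c1" "represents c1 (?nf c)"
    using reach[OF c] by blast
  obtain d1 where d1: "(switch_avoiding FE {e. f 11 \<in> e})\<^sup>*\<^sup>* d d1" "represents d1 (?nf d)"
    using reach[OF d] by blast
  have eq: "c (franklin_edge f p) = d (franklin_edge f p)" if "p \<in> set franklin" "snd p = 11" for p
  proof -
    have "franklin_edge f p \<in> FE" using that(1) unfolding franklin_edges_def by (rule imageI)
    moreover have "f 11 \<in> franklin_edge f p" using that(2) unfolding mem_edge by simp
    ultimately show ?thesis using agree by blast
  qed
  have "(2, 11) \<in> set franklin" "(3, 11) \<in> set franklin" "(5, 11) \<in> set franklin"
    by (simp_all add: franklin_def)
  then have "?nf c = ?nf d" by (simp add: eq)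
  then have "represents d1 (?nf c)" using d1(2) by simp
  \<comment> \<open>A list determines a colouring on the edges only, so \<open>c1\<close> and
    \<open>d1\<close> are linked by an empty switch instead of being equal.\<close>
  then have "\<forall>e\<in>FE. d1 e = c1 e" using represents_inj[OF _ c1(2)] by blast
  then have "switch_avoiding FE {e. f 11 \<in> e} c1 d1" by (rule switch_avoiding_agree)
  then show "(switch_avoiding FE {e. f 11 \<in> e})\<^sup>*\<^sup>* c d"
    using c1(1) switches_sym[OF d1(1)] by (meson rtranclp.rtrancl_into_rtrancl rtranclp_trans)
qed

lemma franklin_proper3: "\<exists>c. proper3 FE c"
proof -
  define col where "col p = the (map_of (zip franklin (normal_form 1 2 3)) p)" for p
  have "list_all (\<lambda>p. the (map_of (zip franklin (normal_form 1 2 3)) p) \<in> set [1, 2, 3] \<and>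
      list_all (\<lambda>q. p \<noteq> q \<and> meets p q \<longrightarrow> the (map_of (zip franklin (normal_form 1 2 3)) p) \<noteq>
        the (map_of (zip franklin (normal_form 1 2 3)) q)) franklin) franklin"
    by code_simp
  then have col: "\<And>p. p \<in> set franklin \<Longrightarrow> col p \<in> {1, 2, 3}"
    "\<And>p q. p \<in> set franklin \<Longrightarrow> q \<in> set franklin \<Longrightarrow> p \<noteq> q \<Longrightarrow> meets p q \<Longrightarrow> col p \<noteq> col q"
    unfolding list_all_iff col_def[symmetric] by auto
  define c where "c e = col (inv_into (set franklin) (franklin_edge f) e)" for e
  have c: "c (franklin_edge f p) = col p" if "p \<in> set franklin" for p
    unfolding c_def using inv_into_f_f[OF inj_edge that] by simp
  have "proper3 FE c"
    unfolding proper3_def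
  proof (intro conjI ballI impI)
    fix e assume "e \<in> FE"
    then obtain p where "p \<in> set franklin" "e = franklin_edge f p" unfolding franklin_edges_def by blast
    then show "c e \<in> {1, 2, 3}" using c[of p] col(1)[of p] by simp
  next
    fix e e' assume e: "e \<in> FE" "e' \<in> FE" and ne: "e \<noteq> e' \<and> e \<inter> e' \<noteq> {}"
    obtain p q where pq: "p \<in> set franklin" "e = franklin_edge f p" "q \<in> set franklin" "e' = franklin_edge f q"
      using e unfolding franklin_edges_def by blast
    have "p \<noteq> q" "meets p q" using ne pq edges_meet(1) by auto
    then show "c e \<noteq> c e'" using col(2) c pq by simp
  qed
  then show ?thesis by blast
qed

lemma f_11_in: "f 11 \<in> FV"
  unfolding franklin_verts_def by simp

end

section \<open>The family of graphs\<close>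

text \<open>Three colours occur once each at \<open>v\<close> and once each at \<open>u\<close>.
  Pairing neighbours by colour makes the two colourings fit together along the cut.\<close>

lemma star_product_matching_colours:
  assumes "simple_graph V E" "simple_graph V' E'" "cubic V E" "cubic V' E'" "V \<inter> V' = {}" "v \<in> V" "u \<in> V'"
    and c: "proper3 E c" and c': "proper3 E' c'"
  shows "\<exists>\<sigma> \<tau>. star_product V E v V' E' u \<sigma> \<tau> \<and> (\<forall>x\<in>nbrs E v. c {x, v} = c' {\<sigma> x, u})"
proof -
  let ?g = "\<lambda>x. c {x, v}" and ?h = "\<lambda>y. c' {y, u}"
  have g: "bij_betw ?g (nbrs E v) {1, 2, 3}" by (rule colours_at_bij[OF assms(1,3,6) c])
  have h: "bij_betw ?h (nbrs E' u) {1, 2, 3}" by (rule colours_at_bij[OF assms(2,4,7) c'])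
  define \<sigma> where "\<sigma> x = inv_into (nbrs E' u) ?h (?g x)" for x
  define \<tau> where "\<tau> y = inv_into (nbrs E v) ?g (?h y)" for y
  have \<sigma>: "\<sigma> x \<in> nbrs E' u" "?h (\<sigma> x) = ?g x" if "x \<in> nbrs E v" for x
  proof -
    have "?g x \<in> ?h ` nbrs E' u" using bij_betw_apply[OF g that] bij_betw_imp_surj_on[OF h] by simp
    then show "\<sigma> x \<in> nbrs E' u" "?h (\<sigma> x) = ?g x" unfolding \<sigma>_def by (rule inv_into_into, rule f_inv_into_f)
  qed
  have \<tau>: "\<tau> y \<in> nbrs E v" "?g (\<tau> y) = ?h y" if "y \<in> nbrs E' u" for y
  proof -
    have "?h y \<in> ?g ` nbrs E v" using bij_betw_apply[OF h that] bij_betw_imp_surj_on[OF g] by simp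
    then show "\<tau> y \<in> nbrs E v" "?g (\<tau> y) = ?h y" unfolding \<tau>_def by (rule inv_into_into, rule f_inv_into_f)
  qed
  have "\<tau> (\<sigma> x) = x" if "x \<in> nbrs E v" for x
    using inj_onD[OF bij_betw_imp_inj_on[OF g], of "\<tau> (\<sigma> x)" x] \<sigma>[OF that] \<tau>[of "\<sigma> x"] that by simp
  moreover have "\<sigma> (\<tau> y) = y" if "y \<in> nbrs E' u" for y
    using inj_onD[OF bij_betw_imp_inj_on[OF h], of "\<sigma> (\<tau> y)" y] \<tau>[OF that] \<sigma>[of "\<tau> y"] that by simp
  ultimately have "star_product V E v V' E' u \<sigma> \<tau>"
    using assms(1,2,5-7) \<sigma>(1) \<tau>(1) by unfold_locales blast+
  then show ?thesis using \<sigma>(2) by metis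
qed

text \<open>The induction invariant. Nonplanarity and the class count enter only through conditions
  that pass to star products: a theta configuration, a colouring, and Kempe connectedness.\<close>

definition admissible :: "'a set \<Rightarrow> 'a set set \<Rightarrow> bool" where
  "admissible V E \<longleftrightarrow> simple_graph V E \<and> cubic V E \<and> bipartite V E \<and> k_connected 3 V E \<and>
     (\<exists>c. proper3 E c) \<and> kempe_connected E \<and> (\<exists>ts. theta_minor V E ts)"

lemma (in franklin_graph) admissible_franklin: "admissible FV FE"
  unfolding admissible_def
  using franklin_simple franklin_cubic franklin_bipartite franklin_3_connected franklin_proper3
    franklin_theta_minor kempe_gadget_connected[OF franklin_simple franklin_cubic f_11_in franklin_gadget]
  by blast

lemma admissible_step:
  fixes V :: "nat set"
  assumes "admissible V E"
  shows "\<exists>V' E'. admissible V' (E' :: nat set set) \<and> card V' = card V + 10"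
proof -
  obtain ts c where V: "simple_graph V E" "cubic V E" "bipartite V E" "k_connected 3 V E" "proper3 E c"
    "kempe_connected E" "theta_minor V E ts"
    using assms unfolding admissible_def by blast
  have finV: "finite V" using V(1) unfolding simple_graph_def by blast
  \<comment> \<open>\<open>connected_on\<close> includes nonemptiness, so there is always a vertex
    off the theta subgraph to be replaced.\<close>
  have "V - set ts \<noteq> {}" using V(7) unfolding theta_minor_def connected_on_def by blast
  then obtain v where v: "v \<in> V" "v \<notin> set ts" by blast
  \<comment> \<open>Labels beyond the maximum of \<open>V\<close> make the new copy disjoint from
    \<open>V\<close>.\<close>
  define f where "f k = Suc (Max V) + k" for k
  interpret F: franklin_graph f by unfold_locales (auto simp: inj_def f_def)
  have "V \<inter> F.FV = {}"
  proof -
    have "x \<le> Max V" if "x \<in> V" for x using finV that by simp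
    moreover have "Max V < x" if "x \<in> F.FV" for x using that unfolding franklin_verts_def f_def by auto
    ultimately show ?thesis by (metis disjoint_iff leD)
  qed
  obtain c' where c': "proper3 F.FE c'" using F.franklin_proper3 by blast
  obtain \<sigma> \<tau> where st: "star_product V E v F.FV F.FE (f 11) \<sigma> \<tau>"
    and match: "\<forall>x\<in>nbrs E v. c {x, v} = c' {\<sigma> x, f 11}"
    using star_product_matching_colours[OF V(1) F.franklin_simple V(2) F.franklin_cubic \<open>V \<inter> F.FV = {}\<close> v(1)
      F.f_11_in V(5) c'] by blast
  interpret S: star_product V E v F.FV F.FE "f 11" \<sigma> \<tau> by (rule st)
  have "{f 11} \<subseteq> F.FV" "card {f 11} < 3" using F.f_11_in by auto
  then have "connected_on (F.FV - {f 11}) F.FE" using F.franklin_3_connected unfolding k_connected_def by blast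
  then have "theta_minor S.SV S.SE ts" by (rule S.star_theta_minor[OF V(7) v(2)])
  moreover have "\<exists>g. proper3 S.SE g" by (rule S.star_proper3[OF V(5) c']) (use match in blast)
  ultimately have "admissible S.SV S.SE"
    unfolding admissible_def
    using S.star_simple S.star_cubic[OF V(2) F.franklin_cubic] S.star_bipartite[OF V(3) F.franklin_bipartite]
      S.star_3_connected[OF V(2) F.franklin_cubic V(4) F.franklin_3_connected]
      S.star_kempe_connected[OF V(6) F.franklin_gadget] by blast
  moreover have "card S.SV = card V + 10" using S.star_card F.card_FV by simp
  ultimately show ?thesis by blast
qed

lemma admissible_exists:
  assumes "k \<ge> 1"
  shows "\<exists>(V :: nat set) E. admissible V E \<and> card V = 2 + 10 * k"
  using assms
proof (induction k rule: nat_induct_at_least)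
  case base
  interpret franklin_graph "\<lambda>k :: nat. k" by unfold_locales (simp add: inj_def)
  show ?case using admissible_franklin card_FV by (intro exI[of _ FV] exI[of _ FE]) simp
next
  case (Suc k)
  then obtain V :: "nat set" and E where "admissible V E" "card V = 2 + 10 * k" by blast
  with admissible_step[of V E] show ?case by auto
qed

theorem theorem17:
  fixes k :: nat
  assumes "k \<ge> 1"
  shows "\<exists>(V :: nat set) (E :: nat set set).
           simple_graph V E \<and> \<not> planar V E \<and> k_connected 3 V E \<and>
           bipartite V E \<and> cubic V E \<and> card V = 2 + 10 * k \<and> K_edge3 V E = 1"
proof -
  obtain V :: "nat set" and E where VE: "admissible V E" and card: "card V = 2 + 10 * k"
    using admissible_exists[OF assms] by blast
  then obtain c ts where c: "proper3 E c" and con: "kempe_connected E" and minor: "theta_minor V E ts"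
    and simple: "simple_graph V E"
    unfolding admissible_def by blast
  have "E \<subseteq> Pow V" using simple_graph_edge[OF simple] by blast
  then have "finite E"
    using simple finite_subset unfolding simple_graph_def by blast
  then have "K_edge3 V E = 1" using con c by (rule kempe_connected_K_edge3)
  moreover have "\<not> planar V E" using minor by (rule theta_minor_not_planar)
  ultimately show ?thesis using VE card unfolding admissible_def by blast
qed

end
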